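(* Let $X$ be a nontrivial real reflexive Banach space, $C\subseteq X$ a nonempty set, and let $F,G:C\times C\to\mathbb{R}$ be maximal monotone bifunctions with $F(x,x)=G(x,x)=0$ for all $x\in C$. Let $f_F$ and $f_G$ be representative functions of $A^F$ and $A^G$, respectively. If $$0\in\operatorname{sqri}\big(D(A^F)-D(A^G)\big)$$ (or, equivalently, $0\in\operatorname{sqri}\big(\operatorname{Pr}_X(\operatorname{dom}f_F)-\operatorname{Pr}_X(\operatorname{dom}f_G)\big)$), then $F+G$ is maximal monotone, $A^F+A^G=A^{F+G}$, and $f_F\square_2 f_G$ is a representative function of $A^{F+G}$.
   Context: $X^*$ is the topological dual of $X$, $\langle x^*,x\rangle$ is the value of $x^*\in X^*$ at $x\in X$, $\overline{\mathbb{R}}=\mathbb{R}\cup\{\pm\infty\}$, and $c(x,x^* )=\langle x^*,x\rangle$ on $X\times X^*$. A bifunction $F:C\times C\to\mathbb{R}$ is monotone if $F(x,y)+F(y,x)\le 0$ for all $x,y\in C$. The operator $A^F:X\rightrightarrows X^*$ is defined by $A^F(x)=\{x^*\in X^*:F(x,y)-F(x,x)\ge\langle x^*,y-x\rangle\ \forall y\in C\}$ if $x\in C$ and $A^F(x)=\emptyset$ if $x\notin C$; $D(A^F)=\{x\in X:A^F(x)\ne\emptyset\}$. The monotone bifunction $F$ is maximal monotone if $A^F$ is a maximal monotone operator, i.e. $A^F$ is monotone ($\langle y^*-x^*,y-x\rangle\ge 0$ whenever $x^*\in A^F(x)$, $y^*\in A^F(y)$) and its graph is not properly included in the graph of another monotone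 operator. The sum $A^F+A^G$ is taken pointwise: $(A^F+A^G)(x)=A^F(x)+A^G(x)$. For a monotone operator $T:X\rightrightarrows X^*$ with graph $G(T)=\{(x,x^* ):x^*\in T(x)\}$, a representative function of $T$ is a convex and strongly lower semicontinuous function $h:X\times X^*\to\overline{\mathbb{R}}$ with $h\ge c$ and $G(T)\subseteq\{(x,x^* ):h(x,x^* )=c(x,x^* )\}$. For $f:X\times X^*\to\overline{\mathbb{R}}$, $\operatorname{dom}f=\{(x,x^* ):f(x,x^* )<+\infty\}$, and $\operatorname{Pr}_X(x,x^* )=x$. For proper $f,g:X\times X^*\to\overline{\mathbb{R}}$, $(f\square_2 g)(x,x^* )=\inf\{f(x,u^* )+g(x,x^*-u^* ):u^*\in X^*\}$. For $U\subseteq X$, $\operatorname{sqri}(U)=\{x\in U:\operatorname{cone}(U-x)\text{ is a closed linear subspace}\}$, where $\operatorname{cone}$ denotes the conical hull, $\operatorname{cone}(V)=\bigcup_{\lambda\ge 0}\lambda V$. *)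

theory Defs
  imports "HOL-Analysis.Analysis"
begin

text \<open>
  The dual of \<open>'a\<close> is \<open>'a \<Rightarrow>\<^sub>L real\<close>, and \<open>\<langle>x\<^sup>*, x\<rangle>\<close> is
  \<open>blinfun_apply x\<^sup>* x\<close>.  Set-valued operators are functions into sets of functionals.
\<close>

text \<open>Surjectivity of the canonical embedding into the bidual.\<close>

definition reflexive_space :: "'a::real_normed_vector itself \<Rightarrow> bool" where
  "reflexive_space (_ :: 'a itself) \<longleftrightarrow>
     (\<forall>\<phi> :: ('a \<Rightarrow>\<^sub>L real) \<Rightarrow>\<^sub>L real. \<exists>x::'a. \<forall>u :: 'a \<Rightarrow>\<^sub>L real.
        blinfun_apply \<phi> u = blinfun_apply u x)"

definition graph_of :: "('a::real_normed_vector \<Rightarrow> ('a \<Rightarrow>\<^sub>L real) set) \<Rightarrow> ('a \<times> ('a \<Rightarrow>\<^sub>L real)) set" where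
  "graph_of T = {(x, u). u \<in> T x}"

definition op_domain :: "('a::real_normed_vector \<Rightarrow> ('a \<Rightarrow>\<^sub>L real) set) \<Rightarrow> 'a set" where
  "op_domain T = {x. T x \<noteq> {}}"

definition monotone_operator :: "('a::real_normed_vector \<Rightarrow> ('a \<Rightarrow>\<^sub>L real) set) \<Rightarrow> bool" where
  "monotone_operator T \<longleftrightarrow>
     (\<forall>x y u v. u \<in> T x \<longrightarrow> v \<in> T y \<longrightarrow> blinfun_apply (v - u) (y - x) \<ge> 0)"

definition maximal_monotone_operator :: "('a::real_normed_vector \<Rightarrow> ('a \<Rightarrow>\<^sub>L real) set) \<Rightarrow> bool" where
  "maximal_monotone_operator T \<longleftrightarrow>
     monotone_operator T \<and> \<not> (\<exists>S. monotone_operator S \<and> graph_of T \<subset> graph_of S)"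

text \<open>
  A bifunction on \<open>C \<times> C\<close> is a function on the whole type together with \<open>C\<close>; the
  definitions below only inspect its values on \<open>C \<times> C\<close>.
\<close>

definition monotone_bifunction :: "'a set \<Rightarrow> ('a \<Rightarrow> 'a \<Rightarrow> real) \<Rightarrow> bool" where
  "monotone_bifunction C F \<longleftrightarrow> (\<forall>x\<in>C. \<forall>y\<in>C. F x y + F y x \<le> 0)"

definition bifun_operator ::
    "'a::real_normed_vector set \<Rightarrow> ('a \<Rightarrow> 'a \<Rightarrow> real) \<Rightarrow> 'a \<Rightarrow> ('a \<Rightarrow>\<^sub>L real) set" where
  "bifun_operator C F x =
     (if x \<in> C then {u. \<forall>y\<in>C. F x y - F x x \<ge> blinfun_apply u (y - x)} else {})"

definition maximal_monotone_bifunction ::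
    "'a::real_normed_vector set \<Rightarrow> ('a \<Rightarrow> 'a \<Rightarrow> real) \<Rightarrow> bool" where
  "maximal_monotone_bifunction C F \<longleftrightarrow>
     monotone_bifunction C F \<and> maximal_monotone_operator (bifun_operator C F)"

text \<open>
  For \<open>0 < t < 1\<close> the \<^typ>\<open>ereal\<close> arithmetic realises the usual convention
  \<open>(+\<infinity>) + (-\<infinity>) = +\<infinity>\<close>.
\<close>

definition convex_ereal :: "('b::real_vector \<Rightarrow> ereal) \<Rightarrow> bool" where
  "convex_ereal h \<longleftrightarrow>
     (\<forall>p q. \<forall>t::real. 0 < t \<longrightarrow> t < 1 \<longrightarrow>
        h ((1 - t) *\<^sub>R p + t *\<^sub>R q) \<le> ereal (1 - t) * h p + ereal t * h q)"

definition lower_semicontinuous :: "('b::topological_space \<Rightarrow> ereal) \<Rightarrow> bool" where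
  "lower_semicontinuous h \<longleftrightarrow> (\<forall>p. h p \<le> Liminf (at p) h)"

text \<open>
  The topology on \<open>'a \<times> ('a \<Rightarrow>\<^sub>L real)\<close> is the product of the norm topologies, so lower
  semicontinuity is taken in the strong sense.
\<close>

definition representative_function ::
    "('a::real_normed_vector \<Rightarrow> ('a \<Rightarrow>\<^sub>L real) set) \<Rightarrow> ('a \<times> ('a \<Rightarrow>\<^sub>L real) \<Rightarrow> ereal) \<Rightarrow> bool" where
  "representative_function T h \<longleftrightarrow>
     monotone_operator T \<and> convex_ereal h \<and> lower_semicontinuous h \<and>
     (\<forall>x u. h (x, u) \<ge> ereal (blinfun_apply u x)) \<and>
     graph_of T \<subseteq> {(x, u). h (x, u) = ereal (blinfun_apply u x)}"

definition effective_domain :: "('b \<Rightarrow> ereal) \<Rightarrow> 'b set" where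
  "effective_domain h = {p. h p < \<infinity>}"

definition inf_conv2 ::
    "('a \<times> 'b::ab_group_add \<Rightarrow> ereal) \<Rightarrow> ('a \<times> 'b \<Rightarrow> ereal) \<Rightarrow> 'a \<times> 'b \<Rightarrow> ereal" where
  "inf_conv2 f g = (\<lambda>(x, u). INF w. f (x, w) + g (x, u - w))"

text \<open>The operation \<open>A - B\<close> on sets is set difference, so the Minkowski difference gets its own name.\<close>

definition minkowski_diff :: "'a::ab_group_add set \<Rightarrow> 'a set \<Rightarrow> 'a set" where
  "minkowski_diff A B = {a - b | a b. a \<in> A \<and> b \<in> B}"

text \<open>
  By \<open>cone_hull_expl\<close>, \<open>cone hull V = \<Union>\<lambda>\<ge>0. \<lambda>V\<close>; no convex hull is taken.
\<close>

definition sqri :: "'a::real_normed_vector set \<Rightarrow> 'a set" where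
  "sqri U = {x \<in> U. closed (cone hull ((\<lambda>u. u - x) ` U)) \<and> subspace (cone hull ((\<lambda>u. u - x) ` U))}"

end

theory Submission
  imports Defs
begin

text \<open>
  Write \<open>\<phi>\<close> for the Fitzpatrick function of a maximal monotone graph; it is a supremum of
  continuous affine functions, dominates the duality product, and is dominated by every
  representative function.  To solve \<open>0 \<in> (S + T + J)(x)\<close>, where \<open>J\<close> is the duality mapping, the
  two operators are first decoupled: for each \<open>\<mu> > 0\<close> the Hahn--Banach theorem, applied to
  \<open>\<phi>\<^sub>S(x, u) + \<phi>\<^sub>T(y, v)\<close> plus a self-conjugate quadratic that penalises \<open>y - x\<close> with weight \<open>\<mu>\<close>, gives
  \<open>u \<in> S x\<close> and \<open>v \<in> T y\<close> for which the sum is nonpositive.  As \<open>\<mu> \<rightarrow> \<infinity>\<close> the points stay bounded, and the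
  interiority condition bounds \<open>v\<close> pointwise on the closed subspace \<open>Y\<close> generated by
  \<open>D(S) - D(T)\<close>, hence in norm on \<open>Y\<close> by uniform boundedness.  Since \<open>S + Y\<^sup>\<bottom> = S\<close> and \<open>T + Y\<^sup>\<bottom> = T\<close>,
  the functionals \<open>v\<close> may be replaced by norm-bounded extensions of their restrictions to \<open>Y\<close>; a
  weak cluster point is the required solution.  Translating \<open>S\<close> gives maximality of \<open>S + T\<close>,
  translating \<open>T\<close> shows that half of the difference of the projected domains lies in
  \<open>D(S) - D(T)\<close>, and the same compactness argument gives the lower semicontinuity of the partial
  infimal convolution.
\<close>

subsection \<open>Hahn--Banach\<close>

text \<open>On the diagonal x = y the two Fitzpatrick functions are merely suprema of affine
  functions, so a direct duality argument would need a qualification condition. The penalty is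
  finite and convex on the whole product space, so Hahn-Banach applies without one; the interiority
  condition is spent only afterwards, on compactness. Self-conjugacy is wanted because the primal
  infimum need not be attained: the multiplier, negated, is then itself the solution. Norm bounds on
  u and v separately cannot be expected, since an annihilator of Y may be moved from one to the
  other; only u + v and the values of v on Y are controlled, which forces the detour through
  extensions. The pairing of x with u is not weakly continuous, so limits are taken in the affine
  inequalities defining the Fitzpatrick functions, never in the graphs, and maximality recovers
  graph points at the end. Separation, extension, norming functionals and the penalised problem are
  all instances of \<open>fenchel_multiplier\<close>.\<close>

definition sublinear :: "('a::real_vector \<Rightarrow> real) \<Rightarrow> bool" where
  "sublinear q \<longleftrightarrow> (\<forall>x y. q (x + y) \<le> q x + q y) \<and> (\<forall>x. \<forall>t>0. q (t *\<^sub>R x) = t * q x)"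

lemma sublinear_add: "sublinear q \<Longrightarrow> q (x + y) \<le> q x + q y"
  and sublinear_scale: "sublinear q \<Longrightarrow> t > 0 \<Longrightarrow> q (t *\<^sub>R x) = t * q x"
  by (auto simp: sublinear_def)

lemma sublinear_0:
  assumes "sublinear q"
  shows "q 0 = 0"
  using sublinear_scale[OF assms, of 2 0] by simp

lemma sublinear_neg:
  assumes "sublinear q"
  shows "- q (- x) \<le> q x"
  using sublinear_add[OF assms, of x "- x"] sublinear_0[OF assms] by simp

text \<open>Subadditivity is where the chain matters: of two members, one nearly optimal at x and
  one at y, the smaller serves both points.\<close>

lemma sublinear_chain_Inf:
  assumes "A \<noteq> {}" "\<And>q. q \<in> A \<Longrightarrow> sublinear q"
    and bdd: "\<And>x. bdd_below ((\<lambda>q. q x) ` A)"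
    and chain: "\<And>q r. q \<in> A \<Longrightarrow> r \<in> A \<Longrightarrow> q \<le> r \<or> r \<le> q"
  shows "sublinear (\<lambda>x. INF q\<in>A. q x)"
  unfolding sublinear_def
proof (intro conjI allI impI)
  fix x y :: 'a
  have low: "(INF q\<in>A. q (x + y)) \<le> q x + r y" if qr: "q \<in> A" "r \<in> A" for q r
  proof -
    obtain s where s: "s \<in> A" "s \<le> q" "s \<le> r"
      using chain[OF qr] qr by blast
    have "(INF q\<in>A. q (x + y)) \<le> s (x + y)"
      using s bdd by (intro cINF_lower) auto
    also have "\<dots> \<le> s x + s y" using sublinear_add assms(2) s by blast
    also have "\<dots> \<le> q x + r y" using s by (simp add: le_fun_def add_mono)
    finally show ?thesis .
  qed
  have "(INF q\<in>A. q (x + y)) - (INF r\<in>A. r y) \<le> q x" if "q \<in> A" for q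
  proof -
    have "(INF q\<in>A. q (x + y)) - q x \<le> (INF r\<in>A. r y)"
      using low[OF that] assms(1) by (intro cINF_greatest) (auto simp: algebra_simps)
    then show ?thesis by simp
  qed
  then have "(INF q\<in>A. q (x + y)) - (INF r\<in>A. r y) \<le> (INF q\<in>A. q x)"
    using assms(1) by (intro cINF_greatest)
  then show "(INF q\<in>A. q (x + y)) \<le> (INF q\<in>A. q x) + (INF q\<in>A. q y)" by simp
next
  fix x :: 'a and t :: real assume t: "t > 0"
  \<comment> \<open>One inequality suffices; the reverse one is the same statement for the inverse
    factor.\<close>
  have le: "(INF q\<in>A. q (s *\<^sub>R z)) \<le> s * (INF q\<in>A. q z)" if "s > 0" for s z
  proof -
    have "(INF q\<in>A. q (s *\<^sub>R z)) / s \<le> q z" if q: "q \<in> A" for q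
    proof -
      have "(INF q\<in>A. q (s *\<^sub>R z)) \<le> q (s *\<^sub>R z)"
        using q bdd by (intro cINF_lower) auto
      also have "\<dots> = s * q z" using sublinear_scale assms(2) q \<open>s > 0\<close> by blast
      finally show ?thesis using \<open>s > 0\<close> by (simp add: field_simps)
    qed
    then have "(INF q\<in>A. q (s *\<^sub>R z)) / s \<le> (INF q\<in>A. q z)"
      using assms(1) by (intro cINF_greatest)
    then show ?thesis using \<open>s > 0\<close> by (simp add: field_simps)
  qed
  have "(INF q\<in>A. q x) \<le> inverse t * (INF q\<in>A. q (t *\<^sub>R x))"
    using le[of "inverse t" "t *\<^sub>R x"] t by simp
  then have "t * (INF q\<in>A. q x) \<le> (INF q\<in>A. q (t *\<^sub>R x))"
    using t by (simp add: field_simps)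
  then show "(INF q\<in>A. q (t *\<^sub>R x)) = t * (INF q\<in>A. q x)"
    using le[OF t] by (simp add: order_antisym)
qed

text \<open>The function r z = inf over t \<ge> 0 of q (z + t a) - t q a is again sublinear and lies
  below q (take t = 0), so minimality makes it equal to q. Taking t = 1 then shows that q is
  superadditive.\<close>

lemma sublinear_minimal_linear:
  assumes q: "sublinear q" and min: "\<And>r. sublinear r \<Longrightarrow> r \<le> q \<Longrightarrow> r = q"
  shows "linear q"
proof -
  have ge: "q x + q a \<le> q (x + a)" for x a
  proof -
    define r where "r z = (INF t\<in>{0..}. q (z + t *\<^sub>R a) - t * q a)" for z
    have low: "- q (- z) \<le> q (z + t *\<^sub>R a) - t * q a" if "t \<ge> 0" for z t
    proof (cases "t = 0")
      case False
      then have "t * q a = q (t *\<^sub>R a)" using that sublinear_scale[OF q] by simp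
      also have "\<dots> \<le> q (z + t *\<^sub>R a) + q (- z)"
        using sublinear_add[OF q, of "z + t *\<^sub>R a" "- z"] by simp
      finally show ?thesis by simp
    qed (use sublinear_neg[OF q] in simp)
    have bdd: "bdd_below ((\<lambda>t. q (z + t *\<^sub>R a) - t * q a) ` {0..})" for z
      using low by (intro bdd_belowI2[where m = "- q (- z)"]) auto
    have rle: "r z \<le> q (z + t *\<^sub>R a) - t * q a" if "t \<ge> 0" for z t
      unfolding r_def using bdd that by (intro cINF_lower) auto
    have rge: "c \<le> r z" if "\<And>t. t \<ge> 0 \<Longrightarrow> c \<le> q (z + t *\<^sub>R a) - t * q a" for c z
      unfolding r_def using that by (intro cINF_greatest) auto
    have "sublinear r"
      unfolding sublinear_def
    proof (intro conjI allI impI)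
      fix u v
      have *: "r (u + v) \<le> (q (u + s *\<^sub>R a) - s * q a) + (q (v + t *\<^sub>R a) - t * q a)"
        if "s \<ge> 0" "t \<ge> 0" for s t
        using rle[of "s + t" "u + v"] that sublinear_add[OF q, of "u + s *\<^sub>R a" "v + t *\<^sub>R a"]
        by (simp add: algebra_simps)
      have "r (u + v) - (q (u + s *\<^sub>R a) - s * q a) \<le> r v" if "s \<ge> 0" for s
        using *[OF that] by (intro rge) (simp add: algebra_simps)
      then have "r (u + v) - r v \<le> r u"
        by (intro rge) (simp add: algebra_simps)
      then show "r (u + v) \<le> r u + r v" by simp
    next
      fix z and t :: real assume t: "t > 0"
      have le: "r (s *\<^sub>R y) \<le> s * r y" if "s > 0" for s y
      proof -
        have "r (s *\<^sub>R y) / s \<le> r y"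
        proof (rule rge)
          fix b :: real assume "b \<ge> 0"
          then have "r (s *\<^sub>R y) \<le> q (s *\<^sub>R (y + b *\<^sub>R a)) - (s * b) * q a"
            using rle[of "s * b" "s *\<^sub>R y"] \<open>s > 0\<close> by (simp add: algebra_simps)
          also have "\<dots> = s * (q (y + b *\<^sub>R a) - b * q a)"
            by (simp only: sublinear_scale[OF q \<open>s > 0\<close>]) (simp add: algebra_simps)
          finally show "r (s *\<^sub>R y) / s \<le> q (y + b *\<^sub>R a) - b * q a"
            using \<open>s > 0\<close> by (simp add: field_simps)
        qed
        then show ?thesis using \<open>s > 0\<close> by (simp add: field_simps)
      qed
      have "r z \<le> inverse t * r (t *\<^sub>R z)"
        using le[of "inverse t" "t *\<^sub>R z"] t by simp
      then have "t * r z \<le> r (t *\<^sub>R z)" using t by (simp add: field_simps)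
      then show "r (t *\<^sub>R z) = t * r z" using le[OF t] by (simp add: order_antisym)
    qed
    moreover have "r \<le> q" using rle[of 0] by (simp add: le_fun_def)
    ultimately have "r = q" using min by blast
    then show ?thesis using rle[of 1 x] by simp
  qed
  have add: "q (x + y) = q x + q y" for x y
    using ge sublinear_add[OF q] by (simp add: order_antisym)
  have neg: "q (- x) = - q x" for x
    using add[of x "- x"] sublinear_0[OF q] by simp
  have "q (t *\<^sub>R x) = t *\<^sub>R q x" for t x
  proof (cases t "0::real" rule: linorder_cases)
    case less
    then show ?thesis using sublinear_scale[OF q, of "- t" "- x"] neg by simp
  qed (use sublinear_0[OF q] sublinear_scale[OF q] in auto)
  then show ?thesis using add by (intro linearI) auto
qed

theorem sublinear_dominates_linear:
  assumes "sublinear p"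
  shows "\<exists>L. linear L \<and> (\<forall>x. L x \<le> p x)"
proof -
  define A where "A = {q. sublinear q \<and> q \<le> p}"
  \<comment> \<open>Zorn's lemma for the reversed order: the bound of a chain is its pointwise
    infimum, which is finite because every sublinear q below p satisfies - p (- x) \<le> q
    x.\<close>
  have "\<exists>m\<in>A. \<forall>a\<in>A. m \<ge> a \<longrightarrow> a = m"
  proof (rule predicate_Zorn)
    show "partial_order_on A (relation_of (\<ge>) A)"
      by (auto simp: partial_order_on_def preorder_on_def refl_on_def trans_def antisym_def
          relation_of_def)
  next
    fix K assume K: "K \<in> Chains (relation_of (\<ge>) A)"
    have KA: "K \<subseteq> A" and chain: "\<And>q r. q \<in> K \<Longrightarrow> r \<in> K \<Longrightarrow> q \<le> r \<or> r \<le> q"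
      using K by (auto simp: Chains_def relation_of_def)
    show "\<exists>u\<in>A. \<forall>a\<in>K. a \<ge> u"
    proof (cases "K = {}")
      case True
      then show ?thesis using assms by (auto simp: A_def)
    next
      case False
      have low: "- p (- x) \<le> q x" if "q \<in> K" for q x
      proof -
        have "q (- x) \<le> p (- x)" "sublinear q" using that KA by (auto simp: A_def le_fun_def)
        then show ?thesis using sublinear_neg[of q x] by simp
      qed
      have bdd: "bdd_below ((\<lambda>q. q x) ` K)" for x
        using low by (intro bdd_belowI2)
      have "sublinear (\<lambda>x. INF q\<in>K. q x)"
        using False KA chain bdd by (intro sublinear_chain_Inf) (auto simp: A_def)
      moreover have lower: "(\<lambda>x. INF q\<in>K. q x) \<le> q" if "q \<in> K" for q
        using that bdd by (auto simp: le_fun_def intro!: cINF_lower)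
      moreover obtain q where "q \<in> K" using False by blast
      ultimately have "(\<lambda>x. INF q\<in>K. q x) \<in> A"
        using KA order_trans[OF lower[of q], of p] by (auto simp: A_def)
      then show ?thesis using lower by blast
    qed
  qed
  then obtain q where q: "sublinear q" "q \<le> p" "\<And>r. sublinear r \<Longrightarrow> r \<le> p \<Longrightarrow> r \<le> q \<Longrightarrow> r = q"
    by (auto simp: A_def)
  then have "linear q" using order_trans[of _ q p] by (intro sublinear_minimal_linear) blast+
  then show ?thesis using q by (auto simp: le_fun_def)
qed

text \<open>The multiplier is a linear minorant of the sublinear hull of the value function
  \<open>d \<mapsto> inf {r + k (c + d) | (c, r) \<in> K}\<close>, which is finite because \<open>k\<close> is.\<close>

lemma fenchel_multiplier:
  fixes K :: "('a::real_normed_vector \<times> real) set" and k :: "'a \<Rightarrow> real"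
  assumes "K \<noteq> {}" "convex K" and k: "convex_on UNIV k"
    and ge: "\<And>c r. (c, r) \<in> K \<Longrightarrow> 0 \<le> r + k c"
    and bdd: "\<And>z. norm z \<le> 1 \<Longrightarrow> k (z0 + z) \<le> B"
  shows "\<exists>L :: 'a \<Rightarrow>\<^sub>L real. \<forall>c r y. (c, r) \<in> K \<longrightarrow> L y - k y \<le> r + L c"
proof -
  define I where "I = K \<times> {0::real<..}"
  \<comment> \<open>The factor s > 0 homogenises the value function, so that \<open>q\<close> is
    positively homogeneous; s = 1 gives back the value function itself.\<close>
  define \<phi> where "\<phi> d = (\<lambda>((c, r), s). s * (r + k (c + d /\<^sub>R s)))" for d
  define q where "q d = (INF i\<in>I. \<phi> d i)" for d
  have I: "I \<noteq> {}" using assms(1) by (auto simp: I_def)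
  have key: "\<exists>i\<in>I. \<phi> (d + e) i \<le> \<phi> d i1 + \<phi> e i2" if i: "i1 \<in> I" "i2 \<in> I" for d e i1 i2
  proof -
    obtain c1 r1 s1 c2 r2 s2 where e: "i1 = ((c1, r1), s1)" "i2 = ((c2, r2), s2)"
      by (metis surj_pair)
    have s: "s1 > 0" "s2 > 0" and K: "(c1, r1) \<in> K" "(c2, r2) \<in> K"
      using i by (auto simp: I_def e)
    \<comment> \<open>Subadditivity: the two base points are averaged with weights proportional to
      s1 and s2, and the average is scaled by s1 + s2.\<close>
    define a b where "a = s1 / (s1 + s2)" and "b = s2 / (s1 + s2)"
    have ab: "a \<ge> 0" "b \<ge> 0" "a + b = 1"
      using s by (auto simp: a_def b_def add_divide_distrib[symmetric])
    have sa: "(s1 + s2) * a = s1" "(s1 + s2) * b = s2" using s by (auto simp: a_def b_def)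
    have "a *\<^sub>R (c1, r1) + b *\<^sub>R (c2, r2) \<in> K"
      using convexD[OF assms(2) K] ab by blast
    then have mem: "((a *\<^sub>R c1 + b *\<^sub>R c2, a * r1 + b * r2), s1 + s2) \<in> I"
      using s by (simp add: I_def)
    have "a *\<^sub>R c1 + b *\<^sub>R c2 + (d + e) /\<^sub>R (s1 + s2) = a *\<^sub>R (c1 + d /\<^sub>R s1) + b *\<^sub>R (c2 + e /\<^sub>R s2)"
      using s by (simp add: algebra_simps a_def b_def divide_inverse) (simp add: mult.assoc[symmetric])
    then have "k (a *\<^sub>R c1 + b *\<^sub>R c2 + (d + e) /\<^sub>R (s1 + s2)) \<le> a * k (c1 + d /\<^sub>R s1) + b * k (c2 + e /\<^sub>R s2)"
      using k ab by (simp add: convex_on_def)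
    then have "(s1 + s2) * (a * r1 + b * r2 + k (a *\<^sub>R c1 + b *\<^sub>R c2 + (d + e) /\<^sub>R (s1 + s2)))
       \<le> (s1 + s2) * (a * r1 + b * r2 + (a * k (c1 + d /\<^sub>R s1) + b * k (c2 + e /\<^sub>R s2)))"
      using s by (intro mult_left_mono) auto
    also have "\<dots> = ((s1 + s2) * a) * (r1 + k (c1 + d /\<^sub>R s1)) + ((s1 + s2) * b) * (r2 + k (c2 + e /\<^sub>R s2))"
      by (simp add: algebra_simps)
    finally show ?thesis
      using mem by (intro bexI[OF _ mem]) (simp add: \<phi>_def e sa)
  qed
  have nonneg: "0 \<le> \<phi> 0 i" if "i \<in> I" for i
    using that ge by (auto simp: I_def \<phi>_def)
  obtain i0 where i0: "i0 \<in> I" using I by blast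
  \<comment> \<open>Adding the directions d and - d lands at 0, where the hypothesis
    \<open>ge\<close> gives nonnegativity; hence the infimum is finite.\<close>
  have low: "- \<phi> (- d) i0 \<le> \<phi> d i" if "i \<in> I" for d i
    using key[OF that i0, of d "- d"] nonneg by force
  have bb: "bdd_below (\<phi> d ` I)" for d
    using low by (intro bdd_belowI2)
  have qle: "q d \<le> \<phi> d i" if "i \<in> I" for d i
    unfolding q_def using that bb by (intro cINF_lower)
  have qge: "c \<le> q d" if "\<And>i. i \<in> I \<Longrightarrow> c \<le> \<phi> d i" for c d
    unfolding q_def using that I by (intro cINF_greatest)
  have "sublinear q"
    unfolding sublinear_def
  proof (intro conjI allI impI)
    fix d e
    have "q (d + e) - \<phi> d i \<le> q e" if i: "i \<in> I" for i
    proof (rule qge)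
      fix j assume j: "j \<in> I"
      obtain l where "l \<in> I" "\<phi> (d + e) l \<le> \<phi> d i + \<phi> e j" using key[OF i j] by blast
      then show "q (d + e) - \<phi> d i \<le> \<phi> e j" using qle[of l "d + e"] by linarith
    qed
    then have "q (d + e) - q e \<le> q d" by (intro qge) (simp add: algebra_simps)
    then show "q (d + e) \<le> q d + q e" by simp
  next
    fix d and t :: real assume t: "t > 0"
    have le: "q (s *\<^sub>R z) \<le> s * q z" if "s > 0" for s z
    proof -
      have "q (s *\<^sub>R z) / s \<le> q z"
      proof (rule qge)
        fix i assume i: "i \<in> I"
        obtain c r l where e: "i = ((c, r), l)" by (metis surj_pair)
        have "((c, r), s * l) \<in> I" using i \<open>s > 0\<close> by (simp add: I_def e)
        then have "q (s *\<^sub>R z) \<le> \<phi> (s *\<^sub>R z) ((c, r), s * l)" by (rule qle)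
        also have "(s *\<^sub>R z) /\<^sub>R (s * l) = z /\<^sub>R l" using \<open>s > 0\<close> by simp
        then have "\<phi> (s *\<^sub>R z) ((c, r), s * l) = s * \<phi> z i"
          by (simp only: \<phi>_def e prod.case mult.assoc)
        finally show "q (s *\<^sub>R z) / s \<le> \<phi> z i" using \<open>s > 0\<close> by (simp add: field_simps)
      qed
      then show ?thesis using \<open>s > 0\<close> by (simp add: field_simps)
    qed
    have "q d \<le> inverse t * q (t *\<^sub>R d)"
      using le[of "inverse t" "t *\<^sub>R d"] t by simp
    then have "t * q d \<le> q (t *\<^sub>R d)" using t by (simp add: field_simps)
    then show "q (t *\<^sub>R d) = t * q d" using le[OF t] by (simp add: order_antisym)
  qed
  then obtain L where L: "linear L" "\<And>x. L x \<le> q x"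
    using sublinear_dominates_linear by blast
  have main: "L y - k y \<le> r + L c" if "(c, r) \<in> K" for c r y
  proof -
    have "((c, r), 1) \<in> I" using that by (simp add: I_def)
    from qle[OF this, of "y - c"] have "q (y - c) \<le> r + k y" by (simp add: \<phi>_def)
    then have "L (y - c) \<le> r + k y" using L(2)[of "y - c"] by linarith
    then show ?thesis using linear_diff[OF L(1)] by simp
  qed
  obtain c0 r0 where c0: "(c0, r0) \<in> K" using assms(1) by (metis ex_in_conv surj_pair)
  \<comment> \<open>An upper bound of k on a ball around z0 becomes an upper bound of L on the unit
    ball, which makes L continuous.\<close>
  define b where "b = r0 + L c0 + B - L z0"
  have up: "L z \<le> b" if "norm z \<le> 1" for z
    using main[OF c0, of "z0 + z"] bdd[OF that] linear_add[OF L(1)] by (simp add: b_def)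
  have "bounded_linear L"
  proof (rule bounded_linear_intro[where K = b])
    fix x :: 'a
    show "norm (L x) \<le> norm x * b"
    proof (cases "x = 0")
      case False
      have "L (x /\<^sub>R norm x) \<le> b" "L (- x /\<^sub>R norm x) \<le> b"
        using False by (auto intro!: up)
      then show ?thesis using False linear_neg[OF L(1)]
        by (simp add: linear_scale[OF L(1)] field_simps abs_le_iff)
    qed (simp add: linear_0[OF L(1)])
  qed (simp_all add: linear_add[OF L(1)] linear_scale[OF L(1)])
  then have "blinfun_apply (Blinfun L) = L" by (rule bounded_linear_Blinfun_apply)
  then show ?thesis using main by (intro exI[of _ "Blinfun L"]) simp
qed

section \<open>Separation, norm-controlled extension and norming functionals\<close>

lemma blinfun_norm_le_of_upper:
  fixes L :: "'a::real_normed_vector \<Rightarrow>\<^sub>L real"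
  assumes "0 \<le> M" "\<And>y. L y \<le> M * norm y"
  shows "norm L \<le> M"
proof (rule norm_blinfun_bound[OF assms(1)])
  fix y show "norm (L y) \<le> M * norm y"
    using assms(2)[of y] assms(2)[of "- y"] by (simp add: blinfun.minus_right)
qed

text \<open>Replaces dividing by t and letting t tend to infinity.\<close>

lemma linear_growth_bound:
  fixes A C :: real
  assumes "\<And>t. t > 0 \<Longrightarrow> t * A \<le> C"
  shows "A \<le> 0"
proof (rule ccontr)
  assume "\<not> A \<le> 0"
  then show False
    using assms[of "(\<bar>C\<bar> + 1) / A"] by simp
qed

lemma convex_on_mult_norm:
  "M \<ge> 0 \<Longrightarrow> convex_on UNIV (\<lambda>y::'a::real_normed_vector. M * norm y)"
  using convex_on_cmul[OF _ convex_on_dist[of UNIV "0::'a"], of M] by simp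

text \<open>The multiplier for the set K at height 0 and the function dist e y - \<delta>, where the
  ball of radius \<delta> around e misses K; evaluating at y = e leaves the gap \<delta>.\<close>

lemma separate_point_closed_convex:
  fixes K :: "'a::real_normed_vector set"
  assumes "closed K" "convex K" "e \<notin> K"
  shows "\<exists>(L :: 'a \<Rightarrow>\<^sub>L real) \<delta>. \<delta> > 0 \<and> (\<forall>c\<in>K. L e + \<delta> \<le> L c)"
proof (cases "K = {}")
  case True
  then show ?thesis by (auto intro: exI[of _ 1])
next
  case False
  obtain \<delta> where "\<delta> > 0" "ball e \<delta> \<subseteq> - K"
    using assms(1,3) open_contains_ball[of "- K"] by (auto simp: open_Compl)
  then have \<delta>: "\<delta> > 0" "ball e \<delta> \<inter> K = {}" by auto
  have k: "convex_on UNIV (\<lambda>y. dist e y - \<delta>)"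
    using convex_on_add[OF convex_on_dist[of UNIV e]  convex_on_const[THEN iffD2, of UNIV "- \<delta>"]]
    by simp
  have cK: "convex ((\<lambda>c. (c, 0::real)) ` K)"
    using assms(2) by (auto simp: convex_def image_iff)
  have "\<exists>L :: 'a \<Rightarrow>\<^sub>L real. \<forall>c r y. (c, r) \<in> (\<lambda>c. (c, 0)) ` K \<longrightarrow> L y - (dist e y - \<delta>) \<le> r + L c"
  proof (rule fenchel_multiplier[OF _ cK k])
    fix z :: 'a assume "norm z \<le> 1"
    then show "dist e (e + z) - \<delta> \<le> 1 - \<delta>" by (simp add: dist_norm)
  next
    fix c and r :: real assume "(c, r) \<in> (\<lambda>c. (c, 0)) ` K"
    then have "c \<in> K" "r = 0" by auto
    moreover from this have "c \<notin> ball e \<delta>" using \<delta>(2) by blast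
    ultimately show "0 \<le> r + (dist e c - \<delta>)" by simp
  qed (use False in simp)
  then obtain L :: "'a \<Rightarrow>\<^sub>L real" where L: "\<And>c y. c \<in> K \<Longrightarrow> L y - (dist e y - \<delta>) \<le> 0 + L c"
    by blast
  show ?thesis using \<delta>(1) L[of _ e] by (intro exI[of _ L] exI[of _ \<delta>]) auto
qed

text \<open>A linear functional bounded below on a subspace vanishes there, so a separating
  functional is an annihilator.\<close>

lemma annihilator_separates:
  fixes Y :: "'a::real_normed_vector set"
  assumes "closed Y" "subspace Y" "e \<notin> Y"
  shows "\<exists>L :: 'a \<Rightarrow>\<^sub>L real. (\<forall>y\<in>Y. L y = 0) \<and> L e \<noteq> 0"
proof -
  obtain L :: "'a \<Rightarrow>\<^sub>L real" and \<delta> where L: "\<delta> > 0" "\<And>c. c \<in> Y \<Longrightarrow> L e + \<delta> \<le> L c"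
    using separate_point_closed_convex[OF assms(1) subspace_imp_convex[OF assms(2)] assms(3)] by blast
  have le: "- L c \<le> 0" if "c \<in> Y" for c
  proof (rule linear_growth_bound)
    fix t :: real
    show "t * - L c \<le> - (L e + \<delta>)"
      using L(2)[OF subspace_scale[OF assms(2) that, of t]] by (simp add: blinfun.scaleR_right)
  qed
  have "L c = 0" if "c \<in> Y" for c
    using le[OF that] le[OF subspace_neg[OF assms(2) that]] by (simp add: blinfun.minus_right)
  moreover have "L e + \<delta> \<le> 0" using L(2)[OF subspace_0[OF assms(2)]] by simp
  ultimately show ?thesis using L(1) by (intro exI[of _ L]) auto
qed

text \<open>The multiplier for the graph of - w over Y and the function M * norm y. Setting y = 0
  gives w \<le> L on Y, hence equality on the subspace; setting c = 0 gives the norm bound.\<close>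

lemma hahn_banach_extension:
  fixes Y :: "'a::real_normed_vector set" and w :: "'a \<Rightarrow>\<^sub>L real"
  assumes "subspace Y" "0 \<le> M" "\<And>y. y \<in> Y \<Longrightarrow> w y \<le> M * norm y"
  shows "\<exists>w' :: 'a \<Rightarrow>\<^sub>L real. (\<forall>y\<in>Y. blinfun_apply w' y = w y) \<and> norm w' \<le> M"
proof -
  have cK: "convex ((\<lambda>c. (c, - w c)) ` Y)"
    using subspace_imp_convex[OF assms(1)]
    by (auto simp: convex_def image_iff blinfun.bilinear_simps)
  have "\<exists>L :: 'a \<Rightarrow>\<^sub>L real. \<forall>c r y. (c, r) \<in> (\<lambda>c. (c, - w c)) ` Y \<longrightarrow> L y - M * norm y \<le> r + L c"
  proof (rule fenchel_multiplier[OF _ cK convex_on_mult_norm[OF assms(2)]])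
    fix z :: 'a assume "norm z \<le> 1"
    then show "M * norm (0 + z) \<le> M" using assms(2) by (simp add: mult_left_le)
  qed (use assms subspace_0 in auto)
  then obtain L :: "'a \<Rightarrow>\<^sub>L real" where L: "\<And>c y. c \<in> Y \<Longrightarrow> L y - M * norm y \<le> - w c + L c"
    by blast
  have le: "w c \<le> L c" if "c \<in> Y" for c
    using L[OF that, of 0] by simp
  have "L c = w c" if "c \<in> Y" for c
    using le[OF that] le[OF subspace_neg[OF assms(1) that]] by (simp add: blinfun.minus_right)
  moreover have "norm L \<le> M"
    using L[OF subspace_0[OF assms(1)]] by (intro blinfun_norm_le_of_upper assms(2)) simp
  ultimately show ?thesis by blast
qed

text \<open>The multiplier for the single point (x, - norm x): y = 0 gives norm x \<le> L x, and
  growth along rays gives norm at most 1.\<close>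

lemma norming_functional:
  fixes x :: "'a::real_normed_vector"
  shows "\<exists>b :: 'a \<Rightarrow>\<^sub>L real. norm b \<le> 1 \<and> blinfun_apply b x = norm x"
proof -
  have "\<exists>L :: 'a \<Rightarrow>\<^sub>L real. \<forall>c r y. (c, r) \<in> {(x, - norm x)} \<longrightarrow> L y - 1 * norm y \<le> r + L c"
    by (rule fenchel_multiplier[where ?z0.0 = 0 and B = 1, OF _ _ convex_on_mult_norm]) auto
  then obtain L :: "'a \<Rightarrow>\<^sub>L real" where L: "\<And>y. L y - norm y \<le> - norm x + L x" by auto
  have up: "L y \<le> 1 * norm y" for y
  proof -
    have "L y - norm y \<le> 0"
    proof (rule linear_growth_bound)
      fix t :: real assume "t > 0"
      then show "t * (L y - norm y) \<le> - norm x + L x"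
        using L[of "t *\<^sub>R y"] by (simp add: blinfun.scaleR_right algebra_simps)
    qed
    then show ?thesis by simp
  qed
  have "norm L \<le> 1" using up by (intro blinfun_norm_le_of_upper) auto
  moreover have "L x = norm x" using up[of x] L[of 0] by simp
  ultimately show ?thesis by blast
qed

subsection \<open>Reflexive spaces and uniform boundedness\<close>

text \<open>Composing \<phi> with the canonical embedding \<open>ev\<close> yields the representing
  functional; testing on evaluations suffices because the bidual contains nothing else.\<close>

lemma reflexive_dual:
  assumes "reflexive_space TYPE('a::real_normed_vector)"
  shows "reflexive_space TYPE('a \<Rightarrow>\<^sub>L real)"
  unfolding reflexive_space_def
proof (intro allI)
  fix \<phi> :: "(('a \<Rightarrow>\<^sub>L real) \<Rightarrow>\<^sub>L real) \<Rightarrow>\<^sub>L real"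
  define ev :: "'a \<Rightarrow> ('a \<Rightarrow>\<^sub>L real) \<Rightarrow>\<^sub>L real" where "ev x = Blinfun (\<lambda>u. blinfun_apply u x)" for x
  have ev: "blinfun_apply (ev x) = (\<lambda>u. blinfun_apply u x)" for x
    unfolding ev_def by (intro bounded_linear_Blinfun_apply blinfun.bounded_linear_left)
  have nev: "norm (ev x) \<le> norm x" for x
    by (rule norm_blinfun_bound) (simp, metis ev norm_blinfun mult.commute)
  have "bounded_linear (\<lambda>x. \<phi> (ev x))"
  proof (rule bounded_linear_intro[where K = "norm \<phi>"])
    fix x y :: 'a and r :: real
    have "ev (x + y) = ev x + ev y" "ev (r *\<^sub>R x) = r *\<^sub>R ev x"
      by (auto intro!: blinfun_eqI simp: ev blinfun.bilinear_simps)
    then show "\<phi> (ev (x + y)) = \<phi> (ev x) + \<phi> (ev y)" "\<phi> (ev (r *\<^sub>R x)) = r *\<^sub>R \<phi> (ev x)"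
      by (simp_all add: blinfun.bilinear_simps)
    have "norm (\<phi> (ev x)) \<le> norm \<phi> * norm (ev x)" by (rule norm_blinfun)
    also have "\<dots> \<le> norm x * norm \<phi>"
      using mult_left_mono[OF nev[of x], of "norm \<phi>"] by (simp add: mult.commute)
    finally show "norm (\<phi> (ev x)) \<le> norm x * norm \<phi>" .
  qed
  then have u: "blinfun_apply (Blinfun (\<lambda>x. \<phi> (ev x))) = (\<lambda>x. \<phi> (ev x))"
    by (rule bounded_linear_Blinfun_apply)
  have "\<phi> \<Lambda> = \<Lambda> (Blinfun (\<lambda>x. \<phi> (ev x)))" for \<Lambda>
  proof -
    obtain x where x: "\<And>u. \<Lambda> u = blinfun_apply u x"
      using assms unfolding reflexive_space_def by blast
    then have "\<Lambda> = ev x" by (intro blinfun_eqI) (simp add: ev)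
    then show ?thesis by (simp add: ev u)
  qed
  then show "\<exists>x. \<forall>u. \<phi> u = blinfun_apply u x" by blast
qed

lemma reflexive_prod:
  assumes "reflexive_space TYPE('a::real_normed_vector)" "reflexive_space TYPE('b::real_normed_vector)"
  shows "reflexive_space TYPE('a \<times> 'b)"
  unfolding reflexive_space_def
proof (intro allI)
  fix \<phi> :: "(('a \<times> 'b) \<Rightarrow>\<^sub>L real) \<Rightarrow>\<^sub>L real"
  have bl: "bounded_linear (\<lambda>u. blinfun_apply \<phi> (u o\<^sub>L fst_blinfun))"
    "bounded_linear (\<lambda>u. blinfun_apply \<phi> (u o\<^sub>L snd_blinfun))"
    by (intro bounded_linear_compose[OF blinfun.bounded_linear_right]
        bounded_bilinear.bounded_linear_left[OF bounded_bilinear_blinfun_compose])+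
  obtain a where a: "\<And>u :: 'a \<Rightarrow>\<^sub>L real. blinfun_apply \<phi> (u o\<^sub>L fst_blinfun) = u a"
    using assms(1) bounded_linear_Blinfun_apply[OF bl(1)] unfolding reflexive_space_def by metis
  obtain b where b: "\<And>u :: 'b \<Rightarrow>\<^sub>L real. blinfun_apply \<phi> (u o\<^sub>L snd_blinfun) = u b"
    using assms(2) bounded_linear_Blinfun_apply[OF bl(2)] unfolding reflexive_space_def by metis
  have "\<phi> u = u (a, b)" for u
  proof -
    define u1 u2 where "u1 = Blinfun (\<lambda>x. u (x, 0))" and "u2 = Blinfun (\<lambda>y. u (0, y))"
    have "bounded_linear (\<lambda>x. u (x, 0))" "bounded_linear (\<lambda>y. u (0, y))"
      by (intro bounded_linear_compose[OF blinfun.bounded_linear_right] bounded_linear_Pair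
          bounded_linear_ident bounded_linear_zero)+
    then have u12: "blinfun_apply u1 = (\<lambda>x. u (x, 0))" "blinfun_apply u2 = (\<lambda>y. u (0, y))"
      unfolding u1_def u2_def by (simp_all add: bounded_linear_Blinfun_apply)
    have split: "u (x, y) = u1 x + u2 y" for x y
      by (simp add: u12 flip: blinfun.add_right)
    have "u = (u1 o\<^sub>L fst_blinfun) + (u2 o\<^sub>L snd_blinfun)"
      by (rule blinfun_eqI) (auto simp: split blinfun.add_left)
    then show ?thesis by (metis a b split blinfun.add_right)
  qed
  then show "\<exists>x. \<forall>u. \<phi> u = blinfun_apply u x" by blast
qed

text \<open>Weak sequential compactness enters only through this consequence; the cluster point
  represents a linear functional dominated by \<open>l \<mapsto> limsup l (e n)\<close>.\<close>

lemma reflexive_weak_cluster: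
  fixes e :: "nat \<Rightarrow> 'e::real_normed_vector"
  assumes refl: "reflexive_space TYPE('e)" and B: "\<And>n. norm (e n) \<le> B"
  shows "\<exists>x. \<forall>K. closed K \<longrightarrow> convex K \<longrightarrow> (\<forall>\<^sub>F n in sequentially. e n \<in> K) \<longrightarrow> x \<in> K"
proof -
  \<comment> \<open>\<open>S l\<close> collects the eventual upper bounds of l along the sequence,
    so that \<open>p l\<close> is its limsup.\<close>
  define S :: "('e \<Rightarrow>\<^sub>L real) \<Rightarrow> real set" where "S l = {c. \<forall>\<^sub>F n in sequentially. blinfun_apply l (e n) \<le> c}" for l
  define p where "p l = Inf (S l)" for l
  have B0: "0 \<le> B" using order_trans[OF norm_ge_zero B[of 0]] .
  have abs: "\<bar>l (e n)\<bar> \<le> B * norm l" for l :: "'e \<Rightarrow>\<^sub>L real" and n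
    using norm_blinfun[of l "e n"] mult_right_mono[OF B[of n], of "norm l"]
    by (simp add: mult.commute)
  have ne: "B * norm l \<in> S l" for l
    using abs[of l] by (auto simp: S_def abs_le_iff intro!: always_eventually)
  have low: "- (B * norm l) \<le> c" if c: "c \<in> S l" for l c
  proof -
    obtain n where "blinfun_apply l (e n) \<le> c"
      using c unfolding S_def by (auto dest: eventually_happens)
    then show ?thesis using abs[of l n] by (simp add: abs_le_iff)
  qed
  have ple: "p l \<le> c" if "c \<in> S l" for l c
    unfolding p_def using that low by (intro cInf_lower bdd_belowI) auto
  have pge: "d \<le> p l" if "\<And>c. c \<in> S l \<Longrightarrow> d \<le> c" for l d
    unfolding p_def using that ne[of l] by (intro cInf_greatest) auto
  have "sublinear p"
    unfolding sublinear_def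
  proof (intro conjI allI impI)
    fix l m
    have *: "c + d \<in> S (l + m)" if c: "c \<in> S l" "d \<in> S m" for c d
      using c unfolding S_def by (auto simp: blinfun.add_left elim: eventually_elim2)
    have "p (l + m) - c \<le> p m" if c: "c \<in> S l" for c
      using ple[OF *[OF c]] by (intro pge) (simp add: algebra_simps)
    then have "p (l + m) - p m \<le> p l" by (intro pge) (simp add: algebra_simps)
    then show "p (l + m) \<le> p l + p m" by simp
  next
    fix l and t :: real assume t: "t > 0"
    have le: "p (s *\<^sub>R m) \<le> s * p m" if s: "s > 0" for s m
    proof -
      have "p (s *\<^sub>R m) / s \<le> p m"
      proof (rule pge)
        fix c assume "c \<in> S m"
        then have "s * c \<in> S (s *\<^sub>R m)" using s by (simp add: S_def blinfun.scaleR_left)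
        then show "p (s *\<^sub>R m) / s \<le> c" using ple s by (simp add: field_simps)
      qed
      then show ?thesis using s by (simp add: field_simps)
    qed
    have "p l \<le> inverse t * p (t *\<^sub>R l)" using le[of "inverse t" "t *\<^sub>R l"] t by simp
    then have "t * p l \<le> p (t *\<^sub>R l)" using t by (simp add: field_simps)
    then show "p (t *\<^sub>R l) = t * p l" using le[OF t] by (simp add: order_antisym)
  qed
  then obtain L where L: "linear L" "\<And>l. L l \<le> p l" using sublinear_dominates_linear by blast
  have "bounded_linear L"
  proof (rule bounded_linear_intro[where K = B])
    fix l :: "'e \<Rightarrow>\<^sub>L real"
    have "L l \<le> B * norm l" for l
      by (rule order_trans[OF L(2) ple[OF ne]])
    from this[of l] this[of "- l"] show "norm (L l) \<le> norm l * B"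
      by (simp add: linear_neg[OF L(1)] abs_le_iff mult.commute)
  qed (simp_all add: linear_add[OF L(1)] linear_scale[OF L(1)])
  then obtain x where x: "\<And>l. L l = blinfun_apply l x"
    using refl bounded_linear_Blinfun_apply unfolding reflexive_space_def by metis
  show ?thesis
  proof (intro exI[of _ x] allI impI, rule ccontr)
    fix K assume K: "closed K" "convex K" "\<forall>\<^sub>F n in sequentially. e n \<in> K" "x \<notin> K"
    obtain M :: "'e \<Rightarrow>\<^sub>L real" and \<delta> where M: "\<delta> > 0" "\<And>c. c \<in> K \<Longrightarrow> M x + \<delta> \<le> M c"
      using separate_point_closed_convex[OF K(1,2,4)] by blast
    \<comment> \<open>If x were outside K, a separating functional would push the limsup of - M
      strictly below its value at x.\<close>
    have "- M x - \<delta> \<in> S (- M)"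
      unfolding S_def mem_Collect_eq
    proof (rule eventually_mono[OF K(3)])
      fix n assume "e n \<in> K"
      then show "(- M) (e n) \<le> - M x - \<delta>" using M(2)[of "e n"] by (simp add: blinfun.minus_left)
    qed
    then have "L (- M) \<le> - M x - \<delta>" using L(2) ple by (meson order_trans)
    then show False using M(1) by (simp add: x blinfun.minus_left)
  qed
qed

text \<open>Preimages of closed balls under f are closed and convex, so the cluster property pins
  the value of f wherever the images converge in norm.\<close>

lemma weak_cluster_limit:
  fixes e :: "nat \<Rightarrow> 'e::real_normed_vector" and f :: "'e \<Rightarrow> 'f::real_normed_vector"
  assumes x: "\<And>K. closed K \<Longrightarrow> convex K \<Longrightarrow> (\<forall>\<^sub>F n in sequentially. e n \<in> K) \<Longrightarrow> x \<in> K"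
    and f: "bounded_linear f" and lim: "(\<lambda>n. f (e n)) \<longlonglongrightarrow> l"
  shows "f x = l"
proof -
  have "dist l (f x) \<le> 0 + \<epsilon>" if "\<epsilon> > 0" for \<epsilon>
  proof -
    have "x \<in> f -` cball l \<epsilon>"
    proof (rule x)
      show "closed (f -` cball l \<epsilon>)"
        by (intro closed_vimage closed_cball linear_continuous_on f)
      show "convex (f -` cball l \<epsilon>)"
        by (intro convex_linear_vimage bounded_linear.linear f convex_cball)
      show "\<forall>\<^sub>F n in sequentially. e n \<in> f -` cball l \<epsilon>"
        using tendstoD[OF lim that] by (rule eventually_mono) (simp add: dist_commute)
    qed
    then show ?thesis by simp
  qed
  then have "dist l (f x) \<le> 0" by (rule field_le_epsilon)
  then show ?thesis by simp
qed

text \<open>Baire's theorem is applied inside Y as a space of its own, since Y may have empty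
  interior in the whole space.\<close>

lemma uniform_boundedness_on_subspace:
  fixes f :: "nat \<Rightarrow> 'a::banach \<Rightarrow>\<^sub>L real"
  assumes Y: "closed Y" "subspace Y" and pw: "\<And>y. y \<in> Y \<Longrightarrow> \<exists>B. \<forall>n. \<bar>f n y\<bar> \<le> B"
  shows "\<exists>B\<ge>0. \<forall>n. \<forall>y\<in>Y. \<bar>f n y\<bar> \<le> B * norm y"
proof -
  define T where "T m = {y \<in> Y. \<forall>n. \<bar>f n y\<bar> \<le> real m}" for m :: nat
  have clT: "closed (T m)" for m
  proof -
    have "T m = Y \<inter> (\<Inter>n. {y. \<bar>f n y\<bar> \<le> real m})" by (auto simp: T_def)
    moreover have "closed {y. \<bar>f n y\<bar> \<le> real m}" for n
      by (intro closed_Collect_le continuous_intros)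
    ultimately show ?thesis using Y(1) by (simp add: closed_Int closed_INT)
  qed
  have "\<Union>(range T) = Y"
  proof (intro equalityI subsetI)
    fix y assume y: "y \<in> Y"
    obtain B where B: "\<And>n. \<bar>f n y\<bar> \<le> B" using pw[OF y] by blast
    obtain m :: nat where "B \<le> real m" using real_arch_simple by blast
    then have "y \<in> T m" using y order_trans[OF B] by (auto simp: T_def)
    then show "y \<in> \<Union>(range T)" by blast
  qed (auto simp: T_def)
  moreover have "top_of_set Y interior_of Y = Y"
    using interior_of_topspace[of "top_of_set Y"] by simp
  ultimately have "top_of_set Y interior_of \<Union>(range T) \<noteq> {}"
    using subspace_0[OF Y(2)] by auto
  moreover have "completely_metrizable_space (top_of_set Y)"
    using Y(1) by (intro completely_metrizable_space_closedin completely_metrizable_space_euclidean) auto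
  moreover have "closedin (top_of_set Y) (T m)" for m
    using clT by (intro closed_subset) (auto simp: T_def)
  ultimately obtain m where m: "top_of_set Y interior_of (T m) \<noteq> {}"
    using Baire_category_alt[of "top_of_set Y" "range T"] by (metis countableI_type countable_image imageE)
  then obtain y0 where "y0 \<in> top_of_set Y interior_of (T m)" by blast
  then obtain U where U: "openin (top_of_set Y) U" "y0 \<in> U" "U \<subseteq> T m"
    by (auto simp: interior_of_def)
  then obtain \<rho> where \<rho>: "\<rho> > 0" "ball y0 \<rho> \<inter> Y \<subseteq> U"
    by (auto simp: openin_contains_ball)
  have y0: "y0 \<in> T m" using U by blast
  have "\<bar>f n y\<bar> \<le> (4 * real m / \<rho>) * norm y" if y: "y \<in> Y" for n y
  proof (cases "y = 0")
    case False
    \<comment> \<open>s y has norm \<rho> / 2, so y0 + s y stays in \<open>T m\<close>; comparing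
      the values of f n there and at y0 costs 2 m, and dividing by s gives 4 m / \<rho>.\<close>
    define s where "s = \<rho> / (2 * norm y)"
    have s: "s > 0" using False \<rho> by (simp add: s_def)
    have "y0 + s *\<^sub>R y \<in> ball y0 \<rho>" using s False \<rho>(1) by (simp add: dist_norm s_def)
    moreover have "y0 + s *\<^sub>R y \<in> Y"
      using y y0 Y(2) by (simp add: T_def subspace_add subspace_scale)
    ultimately have "y0 + s *\<^sub>R y \<in> T m" using \<rho>(2) U(3) by blast
    then have "\<bar>f n y0 + s * f n y\<bar> \<le> real m" "\<bar>f n y0\<bar> \<le> real m"
      using y0 by (auto simp: T_def blinfun.add_right blinfun.scaleR_right)
    then have "\<bar>s * f n y\<bar> \<le> 2 * real m" by linarith
    then have "s * \<bar>f n y\<bar> \<le> 2 * real m" using s by (simp add: abs_mult)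
    then show ?thesis using False \<rho>(1) by (simp add: s_def field_simps)
  qed simp
  then show ?thesis using \<rho>(1) by (intro exI[of _ "4 * real m / \<rho>"]) auto
qed

subsection \<open>Maximal monotone graphs\<close>

text \<open>A pointwise form of maximal monotonicity, for sets of pairs rather than operators so
  that translated graphs can be used directly; \<open>maximal_monotone_operator_iff\<close> links it
  to the operator notion.\<close>

definition maxmono :: "('a::real_normed_vector \<times> ('a \<Rightarrow>\<^sub>L real)) set \<Rightarrow> bool" where
  "maxmono M \<longleftrightarrow>
     (\<forall>x u y v. (x, u) \<in> M \<longrightarrow> (y, v) \<in> M \<longrightarrow> 0 \<le> (u - v) (x - y)) \<and>
     (\<forall>x u. (\<forall>y v. (y, v) \<in> M \<longrightarrow> 0 \<le> (u - v) (x - y)) \<longrightarrow> (x, u) \<in> M)"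

text \<open>\<open>fitz_le M x u r\<close> says that the Fitzpatrick function of \<open>M\<close> at \<open>(x, u)\<close> is at most \<open>r\<close>.\<close>

definition fitz_le ::
    "('a::real_normed_vector \<times> ('a \<Rightarrow>\<^sub>L real)) set \<Rightarrow> 'a \<Rightarrow> ('a \<Rightarrow>\<^sub>L real) \<Rightarrow> real \<Rightarrow> bool" where
  "fitz_le M x u r \<longleftrightarrow> (\<forall>y v. (y, v) \<in> M \<longrightarrow> v x + u y - v y \<le> r)"

lemma maxmono_monotone:
  "maxmono M \<Longrightarrow> (x, u) \<in> M \<Longrightarrow> (y, v) \<in> M \<Longrightarrow> 0 \<le> (u - v) (x - y)"
  unfolding maxmono_def by metis

lemma maxmono_maximal:
  assumes M: "maxmono M" and rel: "\<And>y v. (y, v) \<in> M \<Longrightarrow> 0 \<le> (u - v) (x - y)"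
  shows "(x, u) \<in> M"
proof -
  have "\<forall>y v. (y, v) \<in> M \<longrightarrow> 0 \<le> (u - v) (x - y)" using rel by (intro allI impI)
  then show ?thesis by (rule M[unfolded maxmono_def, THEN conjunct2, THEN spec, THEN spec, THEN mp])
qed

lemma maxmono_nonempty:
  assumes "maxmono M"
  shows "M \<noteq> {}"
proof
  assume "M = {}"
  then have "(0, 0) \<in> M" by (intro maxmono_maximal[OF assms]) simp
  then show False using \<open>M = {}\<close> by simp
qed

lemma fitz_leI: "(\<And>y v. (y, v) \<in> M \<Longrightarrow> blinfun_apply v x + blinfun_apply u y - v y \<le> r) \<Longrightarrow> fitz_le M x u r"
  and fitz_leD: "fitz_le M x u r \<Longrightarrow> (y, v) \<in> M \<Longrightarrow> blinfun_apply v x + blinfun_apply u y - v y \<le> r"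
  by (auto simp: fitz_le_def)

lemma fitz_le_mono: "fitz_le M x u r \<Longrightarrow> r \<le> s \<Longrightarrow> fitz_le M x u s"
  by (rule fitz_leI) (erule order_trans[OF fitz_leD])

text \<open>Translates between monotone relatedness to (y, v) and the affine function that (y, v)
  contributes to the Fitzpatrick function.\<close>

lemma fitz_gap:
  fixes u v :: "'a::real_normed_vector \<Rightarrow>\<^sub>L real"
  shows "(u - v) (x - y) = u x - (v x + u y - v y)"
  by (simp add: blinfun.bilinear_simps)

lemma fitz_le_member:
  assumes "maxmono M" "(x, u) \<in> M"
  shows "fitz_le M x u (u x)"
proof (rule fitz_leI)
  fix y v assume "(y, v) \<in> M"
  from maxmono_monotone[OF assms this] show "v x + u y - v y \<le> u x"
    unfolding fitz_gap by simp
qed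

lemma fitz_le_imp_member:
  assumes "maxmono M" "fitz_le M x u (u x)"
  shows "(x, u) \<in> M"
proof (rule maxmono_maximal[OF assms(1)])
  fix y v assume "(y, v) \<in> M"
  from fitz_leD[OF assms(2) this] show "0 \<le> (u - v) (x - y)"
    unfolding fitz_gap by simp
qed

text \<open>A value below the duality product would make (x, u) monotonically related to M, hence a
  member; testing the Fitzpatrick function against (x, u) itself then contradicts this.\<close>

lemma fitz_le_ge:
  assumes M: "maxmono M" and le: "fitz_le M x u r"
  shows "u x \<le> r"
proof (rule ccontr)
  assume not: "\<not> u x \<le> r"
  then have "(x, u) \<in> M" using le by (intro fitz_le_imp_member[OF M] fitz_le_mono[OF le]) simp
  from fitz_leD[OF le this] show False using not by simp
qed

lemma fitz_le_convex:
  assumes "fitz_le M x u r" "fitz_le M y v s" "0 \<le> a" "0 \<le> b" "a + b = 1"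
  shows "fitz_le M (a *\<^sub>R x + b *\<^sub>R y) (a *\<^sub>R u + b *\<^sub>R v) (a * r + b * s)"
  unfolding fitz_le_def
proof (intro allI impI)
  fix z w assume z: "(z, w) \<in> M"
  have "w (a *\<^sub>R x + b *\<^sub>R y) + (a *\<^sub>R u + b *\<^sub>R v) z - w z
      = a * (w x + u z - w z) + b * (w y + v z - w z) + (a + b - 1) * w z"
    by (simp add: blinfun.bilinear_simps algebra_simps)
  also have "\<dots> = a * (w x + u z - w z) + b * (w y + v z - w z)" using assms(5) by simp
  also have "\<dots> \<le> a * r + b * s"
    by (intro add_mono mult_left_mono fitz_leD[OF assms(1) z] fitz_leD[OF assms(2) z] assms(3,4))
  finally show "w (a *\<^sub>R x + b *\<^sub>R y) + (a *\<^sub>R u + b *\<^sub>R v) z - w z \<le> a * r + b * s" .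
qed

text \<open>The two suprema separate, so each can be bounded with the other graph point fixed. Both
  Fitzpatrick values dominate their duality products, whose sum is at least - P; hence equality
  holds throughout and maximality applies. It is used once with the full penalty and once with its
  limit.\<close>

lemma fitz_sum_members:
  assumes M: "maxmono M" and N: "maxmono N"
    and le: "\<And>a s b t. (a, s) \<in> M \<Longrightarrow> (b, t) \<in> N \<Longrightarrow>
      (blinfun_apply s x + blinfun_apply u a - s a) + (blinfun_apply t y + blinfun_apply v b - t b) + P \<le> 0"
    and ge: "- (u x + v y) \<le> P"
  shows "(x, u) \<in> M \<and> (y, v) \<in> N \<and> u x + v y + P \<le> 0"
proof -
  have "fitz_le M x u (- P - (t y + v b - t b))" if "(b, t) \<in> N" for b t
    using le[OF _ that] by (intro fitz_leI) (simp add: algebra_simps)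
  from fitz_le_ge[OF M this] have fN: "fitz_le N y v (- P - u x)"
    by (intro fitz_leI) (simp add: algebra_simps)
  have "fitz_le N y v (- P - (s x + u a - s a))" if "(a, s) \<in> M" for a s
    using le[OF that] by (intro fitz_leI) (simp add: algebra_simps)
  from fitz_le_ge[OF N this] have fM: "fitz_le M x u (- P - v y)"
    by (intro fitz_leI) (simp add: algebra_simps)
  have "v y \<le> - P - u x" using fitz_le_ge[OF N fN] .
  moreover have "(x, u) \<in> M" using ge by (intro fitz_le_imp_member[OF M] fitz_le_mono[OF fM]) simp
  moreover have "(y, v) \<in> N" using ge by (intro fitz_le_imp_member[OF N] fitz_le_mono[OF fN]) simp
  ultimately show ?thesis by simp
qed

subsection \<open>The penalised problem\<close>

lemma convex_on_norm_square:
  assumes "linear T" "0 \<le> c"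
  shows "convex_on UNIV (\<lambda>z. c * (norm (T z :: 'b::real_normed_vector))\<^sup>2)"
proof (intro convex_on_cmul assms(2) convex_onI)
  fix t :: real and x y assume t: "0 < t" "t < 1"
  have "norm (T ((1 - t) *\<^sub>R x + t *\<^sub>R y)) \<le> (1 - t) * norm (T x) + t * norm (T y)"
    using norm_triangle_ineq[of "(1 - t) *\<^sub>R T x" "t *\<^sub>R T y"] t
    by (simp add: linear_add[OF assms(1)] linear_scale[OF assms(1)])
  then have "(norm (T ((1 - t) *\<^sub>R x + t *\<^sub>R y)))\<^sup>2 \<le> ((1 - t) * norm (T x) + t * norm (T y))\<^sup>2"
    by (intro power_mono) auto
  also have "\<dots> \<le> (1 - t) * (norm (T x))\<^sup>2 + t * (norm (T y))\<^sup>2"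
    using convex_onD[OF convex_power2, of t "norm (T x)" "norm (T y)"] t by simp
  finally show "(norm (T ((1 - t) *\<^sub>R x + t *\<^sub>R y)))\<^sup>2 \<le> (1 - t) * (norm (T x))\<^sup>2 + t * (norm (T y))\<^sup>2" .
qed simp

text \<open>The lower bound for the conjugate of c / 2 times the squared norm.\<close>

lemma conj_square_dual:
  fixes w :: "'a::real_normed_vector \<Rightarrow>\<^sub>L real"
  assumes c: "c > 0" and le: "\<And>a. w a - c / 2 * (norm a)\<^sup>2 \<le> R"
  shows "(norm w)\<^sup>2 / (2 * c) \<le> R"
proof -
  have R: "0 \<le> R" using le[of 0] by simp
  have "\<bar>w a\<bar> \<le> sqrt (2 * c * R) * norm a" for a
  proof (cases "a = 0")
    case False
    define q where "q = (norm a)\<^sup>2"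
    have q: "q > 0" using False by (simp add: q_def)
    define s where "s = w a / (c * q)"
    have "(w a)\<^sup>2 / (2 * c * q) = s * w a - c / 2 * (s\<^sup>2 * q)"
      using q c by (simp add: s_def power2_eq_square field_simps)
    also have "\<dots> = w (s *\<^sub>R a) - c / 2 * (norm (s *\<^sub>R a))\<^sup>2"
      by (simp add: blinfun.scaleR_right power_mult_distrib q_def)
    also have "\<dots> \<le> R" by (rule le)
    finally have "(w a)\<^sup>2 \<le> (2 * c * R) * (norm a)\<^sup>2"
      unfolding q_def[symmetric] using q c by (simp add: pos_divide_le_eq mult_ac)
    then have "sqrt ((w a)\<^sup>2) \<le> sqrt ((2 * c * R) * (norm a)\<^sup>2)" by (rule real_sqrt_le_mono)
    then show ?thesis by (simp add: real_sqrt_mult)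
  qed simp
  then have "norm w \<le> sqrt (2 * c * R)" using R c by (intro norm_blinfun_bound) auto
  then have "(norm w)\<^sup>2 \<le> (sqrt (2 * c * R))\<^sup>2" by (intro power_mono) auto
  then show ?thesis using R c by (simp add: field_simps)
qed

text \<open>Tested at the norming functional of x scaled by norm x / c, so no supremum over the
  bidual enters.\<close>

lemma conj_square_primal:
  fixes x :: "'a::real_normed_vector"
  assumes c: "c > 0" and le: "\<And>b :: 'a \<Rightarrow>\<^sub>L real. blinfun_apply b x - c / 2 * (norm b)\<^sup>2 \<le> R"
  shows "(norm x)\<^sup>2 / (2 * c) \<le> R"
proof -
  obtain b :: "'a \<Rightarrow>\<^sub>L real" where b: "norm b \<le> 1" "blinfun_apply b x = norm x"
    using norming_functional by blast
  have "(norm x)\<^sup>2 / (2 * c) = (norm x)\<^sup>2 / c - c / 2 * (norm x / c)\<^sup>2 * 1"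
    using c by (simp add: field_simps power2_eq_square)
  also have "\<dots> \<le> (norm x)\<^sup>2 / c - c / 2 * (norm x / c)\<^sup>2 * (norm b)\<^sup>2"
    using b(1) c by (intro diff_left_mono mult_left_mono) (auto simp: power_le_one)
  also have "\<dots> = ((norm x / c) *\<^sub>R b) x - c / 2 * (norm ((norm x / c) *\<^sub>R b))\<^sup>2"
    using c by (simp add: blinfun.scaleR_left b(2) power_mult_distrib power2_eq_square)
  also have "\<dots> \<le> R" by (rule le)
  finally show ?thesis .
qed

text \<open>Built on u x + v y = (u + v) x + v (y - x): the four squares form two conjugate pairs, x
  with u + v at weight 1 and y - x with v at weight \<mu>. The first pair encodes the duality
  mapping for the sum, the second the decoupling.\<close>

definition penalty ::
    "real \<Rightarrow> 'a::real_normed_vector \<Rightarrow> ('a \<Rightarrow>\<^sub>L real) \<Rightarrow> 'a \<Rightarrow> ('a \<Rightarrow>\<^sub>L real) \<Rightarrow> real" where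
  "penalty \<mu> x u y v =
     1 / 2 * (norm x)\<^sup>2 + 1 / 2 * (norm (u + v))\<^sup>2 + \<mu> / 2 * (norm (y - x))\<^sup>2 + 1 / (2 * \<mu>) * (norm v)\<^sup>2"

lemma young: "\<mu> > 0 \<Longrightarrow> (a::real) * b \<le> \<mu> / 2 * a\<^sup>2 + 1 / (2 * \<mu>) * b\<^sup>2"
proof -
  assume "\<mu> > 0"
  then have "\<mu> / 2 * a\<^sup>2 + 1 / (2 * \<mu>) * b\<^sup>2 - a * b = (\<mu> * a - b)\<^sup>2 / (2 * \<mu>)"
    by (simp add: power2_eq_square field_simps)
  also have "\<dots> \<ge> 0" using \<open>\<mu> > 0\<close> by simp
  finally show ?thesis by simp
qed

lemma penalty_ge:
  fixes u v :: "'a::real_normed_vector \<Rightarrow>\<^sub>L real"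
  assumes "\<mu> > 0"
  shows "- (u x + v y) \<le> penalty \<mu> x u y v"
proof -
  have "- (u x + v y) = - (u + v) x + - v (y - x)" by (simp add: blinfun.bilinear_simps)
  also have "\<dots> \<le> norm x * norm (u + v) + norm (y - x) * norm v"
    using norm_blinfun[of "u + v" x] norm_blinfun[of v "y - x"] by (simp add: mult.commute abs_le_iff)
  also have "\<dots> \<le> penalty \<mu> x u y v"
    using young[of 1 "norm x" "norm (u + v)"] young[OF assms, of "norm (y - x)" "norm v"]
    by (simp add: penalty_def)
  finally show ?thesis .
qed

text \<open>The penalty is its own conjugate.\<close>

lemma penalty_conj:
  fixes \<alpha> \<beta> :: "'a::real_normed_vector \<Rightarrow>\<^sub>L real"
  assumes \<mu>: "\<mu> > 0"
    and le: "\<And>x u y v. \<alpha> x + blinfun_apply u x1 + \<beta> y + blinfun_apply v y1 - penalty \<mu> x u y v \<le> R"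
  shows "penalty \<mu> (- x1) (- \<alpha>) (- y1) (- \<beta>) \<le> R"
proof -
  \<comment> \<open>The substitution u = b - e, y = a + d, v = e separates the four squares, which
    are then maximised one variable at a time.\<close>
  have 0: "(\<alpha> + \<beta>) a + b x1 + \<beta> d + e (y1 - x1) - 1 / 2 * (norm a)\<^sup>2 - 1 / 2 * (norm b)\<^sup>2
      - \<mu> / 2 * (norm d)\<^sup>2 - (1 / \<mu>) / 2 * (norm e)\<^sup>2 \<le> R" for a d :: 'a and b e :: "'a \<Rightarrow>\<^sub>L real"
    using le[of a "b - e" "a + d" e] by (simp add: penalty_def blinfun.bilinear_simps)
  have 1: "(norm (\<alpha> + \<beta>))\<^sup>2 / (2 * 1) \<le> R - (b x1 + \<beta> d + e (y1 - x1) - 1 / 2 * (norm b)\<^sup>2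
      - \<mu> / 2 * (norm d)\<^sup>2 - (1 / \<mu>) / 2 * (norm e)\<^sup>2)" for d :: 'a and b e :: "'a \<Rightarrow>\<^sub>L real"
    using 0[of _ b d e] by (intro conj_square_dual) (auto simp: algebra_simps)
  have 2: "(norm x1)\<^sup>2 / (2 * 1) \<le> R - (norm (\<alpha> + \<beta>))\<^sup>2 / (2 * 1) - (\<beta> d + e (y1 - x1)
      - \<mu> / 2 * (norm d)\<^sup>2 - (1 / \<mu>) / 2 * (norm e)\<^sup>2)" for d :: 'a and e :: "'a \<Rightarrow>\<^sub>L real"
    using 1[of _ d e] by (intro conj_square_primal) (auto simp: algebra_simps)
  have 3: "(norm \<beta>)\<^sup>2 / (2 * \<mu>) \<le> R - (norm (\<alpha> + \<beta>))\<^sup>2 / (2 * 1) - (norm x1)\<^sup>2 / (2 * 1)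
      - (e (y1 - x1) - (1 / \<mu>) / 2 * (norm e)\<^sup>2)" for e :: "'a \<Rightarrow>\<^sub>L real"
    using 2[of _ e] \<mu> by (intro conj_square_dual) (auto simp: algebra_simps)
  have 4: "(norm (y1 - x1))\<^sup>2 / (2 * (1 / \<mu>)) \<le> R - (norm (\<alpha> + \<beta>))\<^sup>2 / (2 * 1)
      - (norm x1)\<^sup>2 / (2 * 1) - (norm \<beta>)\<^sup>2 / (2 * \<mu>)"
    using 3 \<mu> by (intro conj_square_primal) (auto simp: algebra_simps)
  have n: "norm (- \<alpha> - \<beta>) = norm (\<alpha> + \<beta>)" "norm (x1 - y1) = norm (y1 - x1)"
    by (metis minus_add_distrib norm_minus_cancel uminus_add_conv_diff add.commute, rule norm_minus_commute)
  show ?thesis using 4 \<mu> by (simp add: penalty_def n field_simps)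
qed

text \<open>K is the epigraph of the sum of the two Fitzpatrick functions. The penalty is bounded on
  the unit ball, which is all the regularity the multiplier requires.\<close>

proposition penalised_solution:
  fixes M N :: "('a::real_normed_vector \<times> ('a \<Rightarrow>\<^sub>L real)) set"
  assumes refl: "reflexive_space TYPE('a)" and M: "maxmono M" and N: "maxmono N" and \<mu>: "\<mu> > 0"
  shows "\<exists>x u y v. (x, u) \<in> M \<and> (y, v) \<in> N \<and> blinfun_apply u x + blinfun_apply v y + penalty \<mu> x u y v \<le> 0"
proof -
  define k where "k = (\<lambda>((x, u), (y, v)). penalty \<mu> x (u :: 'a \<Rightarrow>\<^sub>L real) y v)"
  define K where "K = {(((x, u), (y, v)), r). \<exists>r1 r2. r = r1 + r2 \<and> fitz_le M x u r1 \<and> fitz_le N y v r2}"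
  have "\<exists>L :: (('a \<times> ('a \<Rightarrow>\<^sub>L real)) \<times> ('a \<times> ('a \<Rightarrow>\<^sub>L real))) \<Rightarrow>\<^sub>L real.
      \<forall>c r y. (c, r) \<in> K \<longrightarrow> L y - k y \<le> r + L c"
  proof (rule fenchel_multiplier)
    obtain x u y v where "(x, u) \<in> M" "(y, v) \<in> N"
      using maxmono_nonempty[OF M] maxmono_nonempty[OF N] by (metis ex_in_conv surj_pair)
    then show "K \<noteq> {}" using fitz_le_member M N by (fastforce simp: K_def)
    show "convex K"
    proof (rule convexI)
      fix p q and a b :: real
      assume pq: "p \<in> K" "q \<in> K" and ab: "0 \<le> a" "0 \<le> b" "a + b = 1"
      obtain x1 u1 y1 v1 r1 s1 where p: "p = (((x1, u1), (y1, v1)), r1 + s1)"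
        "fitz_le M x1 u1 r1" "fitz_le N y1 v1 s1" using pq(1) by (auto simp: K_def)
      obtain x2 u2 y2 v2 r2 s2 where q: "q = (((x2, u2), (y2, v2)), r2 + s2)"
        "fitz_le M x2 u2 r2" "fitz_le N y2 v2 s2" using pq(2) by (auto simp: K_def)
      have "a * (r1 + s1) + b * (r2 + s2) = (a * r1 + b * r2) + (a * s1 + b * s2)"
        by (simp add: algebra_simps)
      then show "a *\<^sub>R p + b *\<^sub>R q \<in> K"
        using fitz_le_convex[OF p(2) q(2) ab] fitz_le_convex[OF p(3) q(3) ab]
        unfolding K_def p(1) q(1) by auto
    qed
    have lin: "linear (\<lambda>z::('a \<times> ('a \<Rightarrow>\<^sub>L real)) \<times> ('a \<times> ('a \<Rightarrow>\<^sub>L real)). fst (fst z))"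
      "linear (\<lambda>z::('a \<times> ('a \<Rightarrow>\<^sub>L real)) \<times> ('a \<times> ('a \<Rightarrow>\<^sub>L real)). snd (fst z) + snd (snd z))"
      "linear (\<lambda>z::('a \<times> ('a \<Rightarrow>\<^sub>L real)) \<times> ('a \<times> ('a \<Rightarrow>\<^sub>L real)). fst (snd z) - fst (fst z))"
      "linear (\<lambda>z::('a \<times> ('a \<Rightarrow>\<^sub>L real)) \<times> ('a \<times> ('a \<Rightarrow>\<^sub>L real)). snd (snd z))"
      by (auto intro!: linearI simp: algebra_simps)
    have "convex_on UNIV (\<lambda>z::('a \<times> ('a \<Rightarrow>\<^sub>L real)) \<times> ('a \<times> ('a \<Rightarrow>\<^sub>L real)). 1 / 2 * (norm (fst (fst z)))\<^sup>2 + 1 / 2 * (norm (snd (fst z) + snd (snd z)))\<^sup>2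
        + \<mu> / 2 * (norm (fst (snd z) - fst (fst z)))\<^sup>2 + 1 / (2 * \<mu>) * (norm (snd (snd z)))\<^sup>2)"
      by (rule convex_on_add convex_on_norm_square lin | use \<mu> in simp)+
    then show "convex_on UNIV k" by (simp add: k_def penalty_def case_prod_unfold)
    fix z :: "('a \<times> ('a \<Rightarrow>\<^sub>L real)) \<times> ('a \<times> ('a \<Rightarrow>\<^sub>L real))"
    assume z: "norm z \<le> 1"
    obtain x u y v where zz: "z = ((x, u), (y, v))" by (metis surj_pair)
    have "norm x \<le> 1" "norm u \<le> 1" "norm y \<le> 1" "norm v \<le> 1"
      using z norm_fst_le[of x u] norm_snd_le[of u x] norm_fst_le[of y v] norm_snd_le[of v y]
        norm_fst_le[of "(x, u)" "(y, v)"] norm_snd_le[of "(y, v)" "(x, u)"]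
      unfolding zz by linarith+
    then have le: "norm x \<le> 1" "norm (u + v) \<le> 2" "norm (y - x) \<le> 2" "norm v \<le> 1"
      using norm_triangle_ineq[of u v] norm_triangle_ineq4[of y x] by auto
    have "penalty \<mu> x u y v \<le> 1 / 2 * 1\<^sup>2 + 1 / 2 * 2\<^sup>2 + \<mu> / 2 * 2\<^sup>2 + 1 / (2 * \<mu>) * 1\<^sup>2"
      unfolding penalty_def
      using \<mu> by (intro add_mono mult_left_mono le[THEN power_mono]) auto
    then show "k (0 + z) \<le> 1 / 2 * 1\<^sup>2 + 1 / 2 * 2\<^sup>2 + \<mu> / 2 * 2\<^sup>2 + 1 / (2 * \<mu>) * 1\<^sup>2"
      by (simp add: k_def zz)
  next
    fix c r assume "(c, r) \<in> K"
    then obtain x u y v r1 r2 where c: "c = ((x, u), (y, v))" "r = r1 + r2"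
      "fitz_le M x u r1" "fitz_le N y v r2" by (auto simp: K_def)
    then show "0 \<le> r + k c"
      using fitz_le_ge[OF M c(3)] fitz_le_ge[OF N c(4)] penalty_ge[OF \<mu>, of u x v y]
      by (simp add: k_def)
  qed
  then obtain L :: "(('a \<times> ('a \<Rightarrow>\<^sub>L real)) \<times> ('a \<times> ('a \<Rightarrow>\<^sub>L real))) \<Rightarrow>\<^sub>L real"
    where L: "\<And>c r y. (c, r) \<in> K \<Longrightarrow> L y - k y \<le> r + L c" by blast
  \<comment> \<open>Reflexivity represents the components of L on the dual factors by points x1 and
    y1.\<close>
  define \<alpha> \<beta> where "\<alpha> = Blinfun (\<lambda>x. L ((x, 0), 0))" and "\<beta> = Blinfun (\<lambda>y. L (0, (y, 0)))"
  have bl: "bounded_linear (\<lambda>x. L ((x, 0), 0))" "bounded_linear (\<lambda>y. L (0, (y, 0)))"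
    "bounded_linear (\<lambda>u. L ((0, u), 0))" "bounded_linear (\<lambda>v. L (0, (0, v)))"
    by (intro bounded_linear_compose[OF blinfun.bounded_linear_right] bounded_linear_Pair
        bounded_linear_ident bounded_linear_zero)+
  have \<alpha>\<beta>: "\<And>x. \<alpha> x = L ((x, 0), 0)" "\<And>y. \<beta> y = L (0, (y, 0))"
    unfolding \<alpha>_def \<beta>_def by (simp_all add: bounded_linear_Blinfun_apply bl)
  obtain x1 where x1: "\<And>u. L ((0, u), 0) = blinfun_apply u x1"
    using refl bounded_linear_Blinfun_apply[OF bl(3)] unfolding reflexive_space_def by metis
  obtain y1 where y1: "\<And>v. L (0, (0, v)) = blinfun_apply v y1"
    using refl bounded_linear_Blinfun_apply[OF bl(4)] unfolding reflexive_space_def by metis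
  have split: "L ((x, u), (y, v)) = \<alpha> x + u x1 + \<beta> y + v y1" for x u y v
    by (simp add: \<alpha>\<beta> x1[symmetric] y1[symmetric] flip: blinfun.add_right)
  define P where "P = penalty \<mu> (- x1) (- \<alpha>) (- y1) (- \<beta>)"
  \<comment> \<open>The multiplier inequality is tested only at graph points of K and maximised over
    the free argument; the conjugate that appears is the penalty again.\<close>
  have key: "P \<le> s a + t b + (\<alpha> a + s x1 + \<beta> b + t y1)" if "(a, s) \<in> M" "(b, t) \<in> N" for a s b t
    unfolding P_def
  proof (rule penalty_conj[OF \<mu>])
    fix x y :: 'a and u v :: "'a \<Rightarrow>\<^sub>L real"
    have "(((a, s), (b, t)), s a + t b) \<in> K"
      using fitz_le_member[OF M that(1)] fitz_le_member[OF N that(2)] by (simp add: K_def) blast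
    from L[OF this, of "((x, u), (y, v))"]
    show "\<alpha> x + u x1 + \<beta> y + v y1 - penalty \<mu> x u y v \<le> s a + t b + (\<alpha> a + s x1 + \<beta> b + t y1)"
      by (simp add: split k_def)
  qed
  have "(- x1, - \<alpha>) \<in> M \<and> (- y1, - \<beta>) \<in> N \<and> (- \<alpha>) (- x1) + (- \<beta>) (- y1) + P \<le> 0"
  proof (rule fitz_sum_members[OF M N])
    fix a s b t assume "(a, s) \<in> M" "(b, t) \<in> N"
    from key[OF this]
    show "(s (- x1) + (- \<alpha>) a - s a) + (t (- y1) + (- \<beta>) b - t b) + P \<le> 0"
      by (simp add: blinfun.bilinear_simps algebra_simps)
  qed (use penalty_ge[OF \<mu>] in \<open>simp add: P_def\<close>)
  then show ?thesis unfolding P_def by blast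
qed

subsection \<open>Solving the inclusion for the sum\<close>

lemma closed_convex_sublevel:
  fixes g :: "'a::real_normed_vector \<Rightarrow> real"
  assumes "convex_on UNIV g" "continuous_on UNIV g"
  shows "closed {z. g z \<le> c}" "convex {z. g z \<le> c}"
proof -
  show "closed {z. g z \<le> c}"
    using assms(2) by (intro closed_Collect_le continuous_intros)
  show "convex {z. g z \<le> c}"
  proof (rule convexI)
    fix x y :: 'a and u v :: real
    assume *: "x \<in> {z. g z \<le> c}" "y \<in> {z. g z \<le> c}" "0 \<le> u" "0 \<le> v" "u + v = 1"
    have "g (u *\<^sub>R x + v *\<^sub>R y) \<le> u * g x + v * g y"
      using assms(1) * by (simp add: convex_on_def)
    also have "\<dots> \<le> c" using * by (intro convex_bound_le) auto
    finally show "u *\<^sub>R x + v *\<^sub>R y \<in> {z. g z \<le> c}" by simp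
  qed
qed

lemma convex_on_linear:
  assumes "linear f"
  shows "convex_on UNIV f"
  by (intro convex_onI) (simp_all add: linear_add[OF assms] linear_scale[OF assms])

text \<open>z kills every difference from x to the domain of M, so adding it to u leaves all
  monotonicity products unchanged.\<close>

lemma maxmono_add_annihilator:
  fixes z :: "'a::real_normed_vector \<Rightarrow>\<^sub>L real"
  assumes M: "maxmono M" and xu: "(x, u) \<in> M" and z: "\<And>y v. (y, v) \<in> M \<Longrightarrow> z (x - y) = 0"
  shows "(x, u + z) \<in> M"
proof (rule maxmono_maximal[OF M])
  fix y v assume yv: "(y, v) \<in> M"
  have "(u + z - v) (x - y) = (u - v) (x - y) + z (x - y)"
    by (simp add: blinfun.add_left blinfun.diff_left)
  then show "0 \<le> (u + z - v) (x - y)"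
    using maxmono_monotone[OF M xu yv] z[OF yv] by simp
qed

lemma quadratic_bound:
  fixes p w d m r A :: real
  assumes "1 / 2 * p\<^sup>2 + 1 / 2 * w\<^sup>2 + m / 2 * d\<^sup>2 \<le> r + A * w + A * p + A * d" and m: "1 \<le> m"
  shows "p\<^sup>2 \<le> 4 * (r + 3 * A\<^sup>2)" "w\<^sup>2 \<le> 4 * (r + 3 * A\<^sup>2)" "m * d\<^sup>2 \<le> 4 * (r + 3 * A\<^sup>2)"
proof -
  have y: "A * q \<le> A\<^sup>2 + 1 / 4 * q\<^sup>2" for q
    using zero_le_power2[of "A - q / 2"] by (simp add: power2_diff power_divide)
  have "d\<^sup>2 \<le> m * d\<^sup>2" using mult_right_mono[OF m, of "d\<^sup>2"] by simp
  with y[of p] y[of w] y[of d] assms(1)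
  have "1 / 4 * p\<^sup>2 + 1 / 4 * w\<^sup>2 + 1 / 4 * (m * d\<^sup>2) \<le> r + 3 * A\<^sup>2" by simp
  moreover have "0 \<le> p\<^sup>2" "0 \<le> w\<^sup>2" "0 \<le> m * d\<^sup>2" using m by auto
  moreover have "P \<le> 4 * R \<and> W \<le> 4 * R \<and> D \<le> 4 * R"
    if "1 / 4 * P + 1 / 4 * W + 1 / 4 * D \<le> R" "0 \<le> P" "0 \<le> W" "0 \<le> D" for P W D R :: real
    using that by simp
  ultimately show "p\<^sup>2 \<le> 4 * (r + 3 * A\<^sup>2)" "w\<^sup>2 \<le> 4 * (r + 3 * A\<^sup>2)" "m * d\<^sup>2 \<le> 4 * (r + 3 * A\<^sup>2)"
    by blast+
qed

text \<open>The inequality says that - (u + v) lies in the duality mapping at x. The hypothesis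
  \<open>dom\<close> speaks of Fitzpatrick domains, which contain the graph domains, so that it also
  fits the projected domains of representative functions.\<close>

proposition sum_solution:
  fixes M N :: "('a::banach \<times> ('a \<Rightarrow>\<^sub>L real)) set" and Y :: "'a set"
  assumes refl: "reflexive_space TYPE('a)" and M: "maxmono M" and N: "maxmono N"
    and Y: "closed Y" "subspace Y"
    and MN: "\<And>a s b t. (a, s) \<in> M \<Longrightarrow> (b, t) \<in> N \<Longrightarrow> a - b \<in> Y"
    and dom: "\<And>y. y \<in> Y \<Longrightarrow>
      \<exists>\<tau>>0. \<exists>a s r b t q. \<tau> *\<^sub>R y = a - b \<and> fitz_le M a s r \<and> fitz_le N b t q"
  shows "\<exists>x u v. (x, u) \<in> M \<and> (x, v) \<in> N \<and>
    blinfun_apply (u + v) x + 1 / 2 * (norm x)\<^sup>2 + 1 / 2 * (norm (u + v))\<^sup>2 \<le> 0"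
proof -
  have "\<exists>x u y v. (x, u) \<in> M \<and> (y, v) \<in> N \<and>
      blinfun_apply u x + blinfun_apply v y + penalty (real (Suc n)) x u y v \<le> 0" for n
    by (rule penalised_solution[OF refl M N]) simp
  then obtain x u y v where xu: "\<And>n. (x n, u n) \<in> M" and yv: "\<And>n. (y n, v n) \<in> N"
    and pen: "\<And>n::nat. blinfun_apply (u n) (x n) + blinfun_apply (v n) (y n) + penalty (real (Suc n)) (x n) (u n) (y n) (v n) \<le> 0"
    by metis
  have MY: "a - a' \<in> Y" if "(a, s) \<in> M" "(a', s') \<in> M" for a s a' s'
    using subspace_diff[OF Y(2) MN[OF that(1) yv] MN[OF that(2) yv], of 0 0] by simp
  have NY: "b - b' \<in> Y" if "(b, t) \<in> N" "(b', t') \<in> N" for b t b' t'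
    using subspace_diff[OF Y(2) MN[OF xu that(2)] MN[OF xu that(1)], of 0 0] by simp
  have below: "u n a + v n b \<le> r + q - s (x n) - t (y n) + (u n (x n) + v n (y n))"
    if "fitz_le M a s r" "fitz_le N b t q" for a s r b t q n
    using fitz_leD[OF that(1) xu[of n]] fitz_leD[OF that(2) yv[of n]] by linarith

  \<comment> \<open>\<open>dom\<close> at 0 yields one point in both Fitzpatrick domains. At this
    common point only u + v appears, which the penalty controls.\<close>
  obtain a0 s0 r0 t0 q0 where 0: "fitz_le M a0 s0 r0" "fitz_le N a0 t0 q0"
    using dom[OF subspace_0[OF Y(2)]] by auto
  define A where "A = norm a0 + norm s0 + norm t0"
  define Q where "Q = 4 * ((r0 + q0) + 3 * A\<^sup>2)"
  define p w d where "p n = norm (x n)" and "w n = norm (u n + v n)" and "d n = norm (y n - x n)" for n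
  have "1 / 2 * (p n)\<^sup>2 + 1 / 2 * (w n)\<^sup>2 + real (Suc n) / 2 * (d n)\<^sup>2 \<le> (r0 + q0) + A * w n + A * p n + A * d n" for n
  proof -
    have "0 \<le> 1 / (2 * real (Suc n)) * (norm (v n))\<^sup>2" by simp
    then have "1 / 2 * (p n)\<^sup>2 + 1 / 2 * (w n)\<^sup>2 + real (Suc n) / 2 * (d n)\<^sup>2 \<le> - (u n (x n) + v n (y n))"
      using pen[of n] unfolding penalty_def p_def w_def d_def by linarith
    also have "\<dots> \<le> r0 + q0 - (u n a0 + v n a0) - s0 (x n) - t0 (y n)"
      using below[OF 0, of n] by simp
    also have "\<dots> = r0 + q0 - (u n + v n) a0 - s0 (x n) - t0 (x n) - t0 (y n - x n)"
      by (simp add: blinfun.bilinear_simps)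
    also have "\<dots> \<le> r0 + q0 + w n * norm a0 + norm s0 * p n + norm t0 * p n + norm t0 * d n"
      using norm_blinfun[of "u n + v n" a0] norm_blinfun[of s0 "x n"] norm_blinfun[of t0 "x n"]
        norm_blinfun[of t0 "y n - x n"]
      unfolding p_def w_def d_def real_norm_def by linarith
    also have "\<dots> \<le> r0 + q0 + A * w n + A * p n + A * d n"
    proof -
      have nn: "0 \<le> w n" "0 \<le> p n" "0 \<le> d n" by (simp_all add: p_def w_def d_def)
      have "w n * norm a0 \<le> A * w n"
        using mult_left_mono[OF _ nn(1), of "norm a0" A] by (simp add: A_def mult.commute)
      moreover have "(norm s0 + norm t0) * p n \<le> A * p n"
        by (rule mult_right_mono[OF _ nn(2)]) (simp add: A_def)
      moreover have "norm t0 * d n \<le> A * d n"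
        by (rule mult_right_mono[OF _ nn(3)]) (simp add: A_def)
      ultimately show ?thesis by (simp add: distrib_right)
    qed
    finally show ?thesis .
  qed
  from quadratic_bound[OF this] have sq: "(p n)\<^sup>2 \<le> Q" "(w n)\<^sup>2 \<le> Q" "real (Suc n) * (d n)\<^sup>2 \<le> Q" for n
    by (simp_all add: Q_def)
  have dn: "(d n)\<^sup>2 \<le> Q / real (Suc n)" for n
    using sq(3)[of n] by (simp add: field_simps del: of_nat_Suc)
  have Q0: "0 \<le> Q" using sq(1)[of 0] zero_le_power2 order_trans by metis
  have "Q / real (Suc n) \<le> Q / 1" for n
    using Q0 by (intro divide_left_mono) auto
  then have "(d n)\<^sup>2 \<le> Q" for n
    using order_trans[OF dn] by simp
  then have bnd: "p n \<le> sqrt Q" "w n \<le> sqrt Q" "d n \<le> sqrt Q" for n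
    using sq by (auto intro!: real_le_rsqrt)
  have ybnd: "norm (y n) \<le> 2 * sqrt Q" for n
    using norm_triangle_ineq[of "y n - x n" "x n"] bnd(1,3)[of n] by (simp add: p_def d_def)

  have upper: "\<exists>B. \<forall>n. v n z \<le> B" if z: "z \<in> Y" for z
  proof -
    \<comment> \<open>The direction is - z so that b = a + \<tau> z; then \<tau> v z is u a + v b,
      bounded by \<open>below\<close>, minus the bounded quantity (u + v) a.\<close>
    obtain \<tau> a s r b t q where *: "\<tau> > 0" "\<tau> *\<^sub>R (- z) = a - b" "fitz_le M a s r" "fitz_le N b t q"
      using dom[OF subspace_neg[OF Y(2) z]] by blast
    define B where "B = r + q + norm s * sqrt Q + norm t * (2 * sqrt Q) + sqrt Q * norm a"
    have "\<tau> * v n z \<le> B" for n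
    proof -
      have "0 \<le> penalty (real (Suc n)) (x n) (u n) (y n) (v n)" by (simp add: penalty_def)
      then have neg: "u n (x n) + v n (y n) \<le> 0" using pen[of n] by linarith
      have "b = a + \<tau> *\<^sub>R z" using *(2) by (simp add: algebra_simps)
      then have "\<tau> * v n z = (u n a + v n b) - (u n + v n) a"
        by (simp add: blinfun.bilinear_simps)
      also have "\<dots> \<le> r + q - s (x n) - t (y n) - (u n + v n) a"
        using below[OF *(3,4), of n] neg by linarith
      also have "\<dots> \<le> r + q + norm s * p n + norm t * norm (y n) + w n * norm a"
        using norm_blinfun[of "u n + v n" a] norm_blinfun[of s "x n"] norm_blinfun[of t "y n"]
        unfolding p_def w_def real_norm_def by linarith
      also have "\<dots> \<le> B"
        unfolding B_def by (intro add_mono mult_left_mono mult_right_mono bnd ybnd order_refl norm_ge_zero)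
      finally show ?thesis .
    qed
    then show ?thesis using *(1) by (intro exI[of _ "B / \<tau>"]) (simp add: field_simps)
  qed
  have "\<exists>B. \<forall>n. \<bar>v n z\<bar> \<le> B" if z: "z \<in> Y" for z
  proof -
    obtain B1 B2 where B: "\<And>n. v n z \<le> B1" "\<And>n. v n (- z) \<le> B2"
      using upper[OF z] upper[OF subspace_neg[OF Y(2) z]] by blast
    have "\<bar>v n z\<bar> \<le> max B1 B2" for n
      using B(1)[of n] B(2)[of n] by (auto simp: abs_le_iff blinfun.minus_right)
    then show ?thesis by blast
  qed
  then obtain B where B: "B \<ge> 0" "\<And>n z. z \<in> Y \<Longrightarrow> \<bar>v n z\<bar> \<le> B * norm z"
    using uniform_boundedness_on_subspace[OF Y, of v] by blast
  have "\<exists>v' :: 'a \<Rightarrow>\<^sub>L real. (\<forall>z\<in>Y. blinfun_apply v' z = v n z) \<and> norm v' \<le> B" for n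
    using B by (intro hahn_banach_extension[OF Y(2)]) (auto simp: abs_le_iff)
  then obtain v' where v': "\<And>n z. z \<in> Y \<Longrightarrow> blinfun_apply (v' n) z = v n z" "\<And>n. norm (v' n) \<le> B"
    by metis
  \<comment> \<open>The annihilator v - v' is moved over to u. The sum is unchanged, and so is the
    total pairing because x n - y n lies in Y.\<close>
  define u' where "u' n = u n + (v n - v' n)" for n
  have sum': "u' n + v' n = u n + v n" for n by (simp add: u'_def)
  have ann: "(v n - v' n) z = 0" if "z \<in> Y" for n z using v'(1)[OF that] by (simp add: blinfun.diff_left)
  have xu': "(x n, u' n) \<in> M" for n
    unfolding u'_def using xu ann MY by (intro maxmono_add_annihilator[OF M]) blast+
  have yv': "(y n, v' n) \<in> N" for n
  proof -
    have "(y n, v n + (- (v n - v' n))) \<in> N"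
      using ann NY[OF yv] by (intro maxmono_add_annihilator[OF N yv]) (metis blinfun.minus_left minus_zero)
    then show ?thesis by simp
  qed
  have val: "u' n (x n) + v' n (y n) = u n (x n) + v n (y n)" for n
    using ann[OF MN[OF xu yv], of n n n] by (simp add: u'_def blinfun.bilinear_simps)
  have u'bnd: "norm (u' n) \<le> sqrt Q + B" for n
  proof -
    have "u' n = (u n + v n) - v' n" by (simp add: u'_def)
    then show ?thesis using norm_triangle_ineq4[of "u n + v n" "v' n"] bnd(2)[of n] v'(2)[of n]
      by (simp add: w_def)
  qed

  define e where "e n = ((x n, u' n), (y n, v' n))" for n
  have "norm (e n) \<le> (sqrt Q + (sqrt Q + B)) + (2 * sqrt Q + B)" for n
    unfolding e_def
    using bnd(1)[of n] u'bnd ybnd v'(2)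
    by (intro order_trans[OF norm_Pair_le] add_mono) (auto simp: p_def)
  moreover have "reflexive_space TYPE(('a \<times> ('a \<Rightarrow>\<^sub>L real)) \<times> ('a \<times> ('a \<Rightarrow>\<^sub>L real)))"
    by (intro reflexive_prod reflexive_dual refl)
  ultimately obtain e0 where e0: "\<And>K. closed K \<Longrightarrow> convex K \<Longrightarrow> (\<forall>\<^sub>F n in sequentially. e n \<in> K) \<Longrightarrow> e0 \<in> K"
    using reflexive_weak_cluster by metis
  obtain x0 u0 y0 v0 where e0_eq: "e0 = ((x0, u0), (y0, v0))" by (metis surj_pair)
  \<comment> \<open>The growing weight makes y n - x n tend to 0 in norm, so the cluster point has
    equal components.\<close>
  have yx: "y0 = x0"
  proof -
    have "(\<lambda>n. sqrt (Q * inverse (real (Suc n)))) \<longlonglongrightarrow> sqrt (Q * 0)"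
      by (intro tendsto_real_sqrt tendsto_mult_left LIMSEQ_inverse_real_of_nat)
    moreover have "norm (y n - x n) \<le> sqrt (Q * inverse (real (Suc n)))" for n
      using dn[of n] by (intro real_le_rsqrt) (simp add: d_def divide_inverse)
    ultimately have "(\<lambda>n. y n - x n) \<longlonglongrightarrow> 0"
      by (intro Lim_null_comparison[of "\<lambda>n. y n - x n"] always_eventually) auto
    then have "fst (snd e0) - fst (fst e0) = 0"
      by (intro weak_cluster_limit[of e e0 "\<lambda>z. fst (snd z) - fst (fst z)"] e0 bounded_linear_sub
          bounded_linear_compose[OF bounded_linear_fst bounded_linear_fst]
          bounded_linear_compose[OF bounded_linear_fst bounded_linear_snd]) (simp_all add: e_def)
    then show ?thesis by (simp add: e0_eq)
  qed
  define P where "P = 1 / 2 * (norm x0)\<^sup>2 + 1 / 2 * (norm (u0 + v0))\<^sup>2"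
  have "(x0, u0) \<in> M \<and> (y0, v0) \<in> N \<and> u0 x0 + v0 y0 + P \<le> 0"
  proof (rule fitz_sum_members[OF M N])
    fix a s b t assume as: "(a, s) \<in> M" and bt: "(b, t) \<in> N"
    define l where "l z = s (fst (fst z)) + (snd (fst z)) a + t (fst (snd z)) + (snd (snd z)) b"
      for z :: "('a \<times> ('a \<Rightarrow>\<^sub>L real)) \<times> ('a \<times> ('a \<Rightarrow>\<^sub>L real))"
    \<comment> \<open>With the test points fixed, g is convex and continuous, so its sublevel set
      passes to the weak cluster point; the pairings u x and v y have been replaced by affine
      minorants.\<close>
    define g where "g z = l z + 1 / 2 * (norm (fst (fst z)))\<^sup>2 + 1 / 2 * (norm (snd (fst z) + snd (snd z)))\<^sup>2"
      for z :: "('a \<times> ('a \<Rightarrow>\<^sub>L real)) \<times> ('a \<times> ('a \<Rightarrow>\<^sub>L real))"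
    have lin: "linear l" "linear (\<lambda>z::('a \<times> ('a \<Rightarrow>\<^sub>L real)) \<times> ('a \<times> ('a \<Rightarrow>\<^sub>L real)). fst (fst z))"
      "linear (\<lambda>z::('a \<times> ('a \<Rightarrow>\<^sub>L real)) \<times> ('a \<times> ('a \<Rightarrow>\<^sub>L real)). snd (fst z) + snd (snd z))"
      by (auto intro!: linearI simp: l_def blinfun.bilinear_simps algebra_simps)
    have g1: "convex_on UNIV g"
      unfolding g_def by (rule convex_on_add convex_on_linear convex_on_norm_square lin | simp)+
    have g2: "continuous_on UNIV g"
      unfolding g_def l_def by (intro continuous_intros)
    have "e n \<in> {z. g z \<le> s a + t b}" for n
    proof -
      have "0 \<le> real (Suc n) / 2 * (norm (y n - x n))\<^sup>2" "0 \<le> 1 / (2 * real (Suc n)) * (norm (v n))\<^sup>2" by simp_all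
      then have "u' n (x n) + v' n (y n) + 1 / 2 * (norm (x n))\<^sup>2 + 1 / 2 * (norm (u n + v n))\<^sup>2 \<le> 0"
        unfolding val using pen[of n] unfolding penalty_def by linarith
      moreover have "s (x n) + u' n a - s a \<le> u' n (x n)" "t (y n) + v' n b - t b \<le> v' n (y n)"
        using fitz_leD[OF fitz_le_member[OF M xu'] as] fitz_leD[OF fitz_le_member[OF N yv'] bt] .
      ultimately show ?thesis by (simp add: g_def l_def e_def sum')
    qed
    then have "e0 \<in> {z. g z \<le> s a + t b}"
      using closed_convex_sublevel[OF g1 g2] by (intro e0 always_eventually) auto
    then show "(s x0 + u0 a - s a) + (t y0 + v0 b - t b) + P \<le> 0"
      by (simp add: e0_eq g_def l_def P_def)
  next
    have "- (u0 x0 + v0 y0) = - (u0 + v0) x0" by (simp add: yx blinfun.bilinear_simps)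
    also have "\<dots> \<le> norm x0 * norm (u0 + v0)"
      using norm_blinfun[of "u0 + v0" x0] by (simp add: mult.commute abs_le_iff)
    also have "\<dots> \<le> P" using young[of 1 "norm x0" "norm (u0 + v0)"] by (simp add: P_def)
    finally show "- (u0 x0 + v0 y0) \<le> P" .
  qed
  then show ?thesis
    by (intro exI[of _ x0] exI[of _ u0] exI[of _ v0]) (simp add: yx P_def blinfun.add_left)
qed

section \<open>Translated graphs: maximality and domain of the sum\<close>

lemma fitz_le_translate:
  assumes "fitz_le M x u r"
  shows "fitz_le {(y, v). (y + a, v + c) \<in> M} (x - a) (u - c) (r - c x - u a + c a)"
proof (rule fitz_leI)
  fix y v assume "(y, v) \<in> {(y, v). (y + a, v + c) \<in> M}"
  then have "(v + c) x + u (y + a) - (v + c) (y + a) \<le> r"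
    using fitz_leD[OF assms, of "y + a" "v + c"] by simp
  then show "v (x - a) + (u - c) y - v y \<le> r - c x - u a + c a"
    by (simp add: blinfun.bilinear_simps algebra_simps)
qed

lemma maxmono_translate:
  fixes c :: "'a::real_normed_vector \<Rightarrow>\<^sub>L real"
  assumes M: "maxmono M"
  shows "maxmono {(y, v). (y + a, v + c) \<in> M}"
  unfolding maxmono_def
proof (intro conjI allI impI)
  fix x u y v
  assume "(x, u) \<in> {(y, v). (y + a, v + c) \<in> M}" "(y, v) \<in> {(y, v). (y + a, v + c) \<in> M}"
  then have "0 \<le> ((u + c) - (v + c)) ((x + a) - (y + a))"
    using maxmono_monotone[OF M, of "x + a" "u + c" "y + a" "v + c"] by simp
  then show "0 \<le> (u - v) (x - y)" by simp
next
  fix x u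
  assume *: "\<forall>y v. (y, v) \<in> {(y, v). (y + a, v + c) \<in> M} \<longrightarrow> 0 \<le> (u - v) (x - y)"
  have "(x + a, u + c) \<in> M"
  proof (rule maxmono_maximal[OF M])
    fix y v assume "(y, v) \<in> M"
    then have "0 \<le> (u - (v - c)) (x - (y - a))" using *[rule_format, of "y - a" "v - c"] by simp
    then show "0 \<le> (u + c - v) (x + a - y)" by (simp add: algebra_simps)
  qed
  then show "(x, u) \<in> {(y, v). (y + a, v + c) \<in> M}" by simp
qed

text \<open>M is translated by (x0, u0) and N by (x0, 0). For the resulting solution, relatedness of
  (x0, u0) gives (u + v) x \<ge> 0, so both squares vanish and the solution sits at the
  origin.\<close>

proposition sum_maximal:
  fixes M N :: "('a::banach \<times> ('a \<Rightarrow>\<^sub>L real)) set" and Y :: "'a set"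
  assumes refl: "reflexive_space TYPE('a)" and M: "maxmono M" and N: "maxmono N"
    and Y: "closed Y" "subspace Y"
    and MN: "\<And>a s b t. (a, s) \<in> M \<Longrightarrow> (b, t) \<in> N \<Longrightarrow> a - b \<in> Y"
    and dom: "\<And>y. y \<in> Y \<Longrightarrow>
      \<exists>\<tau>>0. \<exists>a s r b t q. \<tau> *\<^sub>R y = a - b \<and> fitz_le M a s r \<and> fitz_le N b t q"
    and rel: "\<And>x u v. (x, u) \<in> M \<Longrightarrow> (x, v) \<in> N \<Longrightarrow> 0 \<le> blinfun_apply (u0 - (u + v)) (x0 - x)"
  shows "\<exists>u v. (x0, u) \<in> M \<and> (x0, v) \<in> N \<and> u0 = u + v"
proof -
  let ?M = "{(y, v). (y + x0, v + u0) \<in> M}" and ?N = "{(y, v). (y + x0, v + 0) \<in> N}"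
  have "\<exists>x u v. (x, u) \<in> ?M \<and> (x, v) \<in> ?N \<and>
    blinfun_apply (u + v) x + 1 / 2 * (norm x)\<^sup>2 + 1 / 2 * (norm (u + v))\<^sup>2 \<le> 0"
  proof (rule sum_solution[OF refl maxmono_translate[OF M] maxmono_translate[OF N] Y])
    fix a s b t assume "(a, s) \<in> ?M" "(b, t) \<in> ?N"
    then show "a - b \<in> Y" using MN[of "a + x0" "s + u0" "b + x0" "t + 0"] by simp
  next
    fix y assume "y \<in> Y"
    then obtain \<tau> a s r b t q where *: "\<tau> > 0" "\<tau> *\<^sub>R y = a - b" "fitz_le M a s r" "fitz_le N b t q"
      using dom by blast
    have "\<tau> *\<^sub>R y = (a - x0) - (b - x0)" using *(2) by simp
    with *(1) fitz_le_translate[OF *(3)] fitz_le_translate[OF *(4)]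
    show "\<exists>\<tau>>0. \<exists>a s r b t q. \<tau> *\<^sub>R y = a - b \<and> fitz_le ?M a s r \<and> fitz_le ?N b t q"
      by blast
  qed
  then obtain x u v where xuv: "(x + x0, u + u0) \<in> M" "(x + x0, v) \<in> N"
    and le: "blinfun_apply (u + v) x + 1 / 2 * (norm x)\<^sup>2 + 1 / 2 * (norm (u + v))\<^sup>2 \<le> 0" by auto
  have "0 \<le> (u0 - (u + u0 + v)) (x0 - (x + x0))" by (rule rel[OF xuv])
  also have "\<dots> = (u + v) x" by (simp add: blinfun.bilinear_simps)
  finally have "0 \<le> (u + v) x" .
  then have "(norm x)\<^sup>2 \<le> 0" "(norm (u + v))\<^sup>2 \<le> 0"
    using le zero_le_power2[of "norm x"] zero_le_power2[of "norm (u + v)"] by linarith+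
  then have "x = 0" "u + v = 0" by simp_all
  then show ?thesis using xuv by (intro exI[of _ "u + u0"] exI[of _ v]) (simp add: algebra_simps)
qed

text \<open>A common domain point of M and of N shifted by w represents w as a difference. The
  factor 1 / 2 makes room for a midpoint argument that restores the domain hypothesis after the
  shift.\<close>

lemma sum_domain:
  fixes M N :: "('a::banach \<times> ('a \<Rightarrow>\<^sub>L real)) set" and Y :: "'a set"
  assumes refl: "reflexive_space TYPE('a)" and M: "maxmono M" and N: "maxmono N"
    and Y: "closed Y" "subspace Y"
    and MN: "\<And>a s b t. (a, s) \<in> M \<Longrightarrow> (b, t) \<in> N \<Longrightarrow> a - b \<in> Y"
    and dom: "\<And>y. y \<in> Y \<Longrightarrow>
      \<exists>\<tau>>0. \<exists>a s r b t q. \<tau> *\<^sub>R y = a - b \<and> fitz_le M a s r \<and> fitz_le N b t q"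
    and w: "w \<in> Y" "fitz_le M a0 s0 r0" "fitz_le N b0 t0 q0" "w = (1 / 2) *\<^sub>R (a0 - b0)"
  shows "\<exists>x u y v. (x, u) \<in> M \<and> (y, v) \<in> N \<and> w = x - y"
proof -
  let ?N = "{(y, v). (y + - w, v + 0) \<in> N}"
  have "\<exists>x u v. (x, u) \<in> M \<and> (x, v) \<in> ?N \<and>
    blinfun_apply (u + v) x + 1 / 2 * (norm x)\<^sup>2 + 1 / 2 * (norm (u + v))\<^sup>2 \<le> 0"
  proof (rule sum_solution[OF refl M maxmono_translate[OF N] Y])
    fix a s b t assume "(a, s) \<in> M" "(b, t) \<in> ?N"
    then have "a - (b + - w) \<in> Y" using MN[of a s "b + - w" "t + 0"] by simp
    from subspace_diff[OF Y(2) this w(1)] show "a - b \<in> Y" by simp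
  next
    fix y assume "y \<in> Y"
    then obtain \<tau> a s r b t q where *: "\<tau> > 0" "\<tau> *\<^sub>R y = a - b" "fitz_le M a s r" "fitz_le N b t q"
      using dom by blast
    \<comment> \<open>Averaging the pair for \<tau> y with the pair (a0, b0) gives the difference
      (\<tau> / 2) y + w, and the shift removes exactly w.\<close>
    define b' where "b' = (1 / 2) *\<^sub>R b + (1 / 2) *\<^sub>R b0"
    have "(\<tau> / 2) *\<^sub>R y = (1 / 2) *\<^sub>R (\<tau> *\<^sub>R y)" by simp
    also have "\<dots> = ((1 / 2) *\<^sub>R a + (1 / 2) *\<^sub>R a0) - (b' - - w)"
      unfolding *(2) w(4) b'_def by (simp add: algebra_simps)
    finally have "(\<tau> / 2) *\<^sub>R y = ((1 / 2) *\<^sub>R a + (1 / 2) *\<^sub>R a0) - (b' - - w)" .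
    moreover have "\<tau> / 2 > 0" using *(1) by simp
    moreover have "fitz_le M ((1 / 2) *\<^sub>R a + (1 / 2) *\<^sub>R a0) ((1 / 2) *\<^sub>R s + (1 / 2) *\<^sub>R s0) (1 / 2 * r + 1 / 2 * r0)"
      by (rule fitz_le_convex[OF *(3) w(2)]) auto
    moreover have "fitz_le N b' ((1 / 2) *\<^sub>R t + (1 / 2) *\<^sub>R t0) (1 / 2 * q + 1 / 2 * q0)"
      unfolding b'_def by (rule fitz_le_convex[OF *(4) w(3)]) auto
    ultimately show "\<exists>\<tau>>0. \<exists>a s r b t q. \<tau> *\<^sub>R y = a - b \<and> fitz_le M a s r \<and> fitz_le ?N b t q"
      using fitz_le_translate[of N b'] by blast
  qed
  then obtain x u v where "(x, u) \<in> M" "(x + - w, v + 0) \<in> N" by auto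
  then show ?thesis by (intro exI[of _ x] exI[of _ u] exI[of _ "x + - w"] exI[of _ "v + 0"]) simp
qed

text \<open>If x - a were outside Y, an annihilator z with z (x - a) nonzero could be added to s
  with any factor; the affine minorants at (x, u) would be unbounded.\<close>

lemma fitz_domain_affine:
  fixes M :: "('a::real_normed_vector \<times> ('a \<Rightarrow>\<^sub>L real)) set"
  assumes M: "maxmono M" and Y: "closed Y" "subspace Y"
    and MY: "\<And>a s b t. (a, s) \<in> M \<Longrightarrow> (b, t) \<in> M \<Longrightarrow> a - b \<in> Y"
    and as: "(a, s) \<in> M" and le: "fitz_le M x u r"
  shows "x - a \<in> Y"
proof (rule ccontr)
  assume "x - a \<notin> Y"
  then obtain z :: "'a \<Rightarrow>\<^sub>L real" where z: "\<And>y. y \<in> Y \<Longrightarrow> z y = 0" "z (x - a) \<noteq> 0"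
    using annihilator_separates[OF Y] by blast
  have *: "\<tau> * z (x - a) \<le> r - s x - u a + s a" for \<tau>
  proof -
    have "(\<tau> *\<^sub>R z) (a - y) = 0" if "(y, v) \<in> M" for y v
      using z(1)[OF MY[OF as that]] by (simp add: blinfun.scaleR_left)
    then have "(a, s + \<tau> *\<^sub>R z) \<in> M" by (rule maxmono_add_annihilator[OF M as])
    from fitz_leD[OF le this] show ?thesis by (simp add: blinfun.bilinear_simps algebra_simps)
  qed
  have "z (x - a) \<le> 0" by (rule linear_growth_bound[OF *])
  moreover have "- z (x - a) \<le> 0"
    using *[of "- t" for t] by (intro linear_growth_bound[of _ "r - s x - u a + s a"]) simp
  ultimately show False using z(2) by simp
qed

section \<open>Operators and their graphs\<close>

lemma monotone_operator_iff:
  "monotone_operator T \<longleftrightarrow> (\<forall>x u y v. u \<in> T x \<longrightarrow> v \<in> T y \<longrightarrow> 0 \<le> (u - v) (x - y))"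
proof -
  have "(v - u) (y - x) = (u - v) (x - y)" for u v :: "'a \<Rightarrow>\<^sub>L real" and x y
    by (simp add: blinfun.bilinear_simps)
  then show ?thesis unfolding monotone_operator_def by metis
qed

lemma maximal_monotone_operator_iff: "maximal_monotone_operator T \<longleftrightarrow> maxmono (graph_of T)"
proof
  assume max: "maximal_monotone_operator T"
  then have mono: "monotone_operator T" by (simp add: maximal_monotone_operator_def)
  show "maxmono (graph_of T)"
    unfolding maxmono_def
  proof (intro conjI allI impI)
    fix x u y v assume "(x, u) \<in> graph_of T" "(y, v) \<in> graph_of T"
    then show "0 \<le> (u - v) (x - y)"
      using mono[unfolded monotone_operator_iff, rule_format, of u x v y] by (simp add: graph_of_def)
  next
    fix x u assume rel: "\<forall>y v. (y, v) \<in> graph_of T \<longrightarrow> 0 \<le> (u - v) (x - y)"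
    \<comment> \<open>The extension by a single related point; maximality forces that point into the
      graph of T.\<close>
    define S where "S y = T y \<union> (if y = x then {u} else {})" for y
    have rel': "0 \<le> (u - v) (x - y)" "0 \<le> (v - u) (y - x)" if "v \<in> T y" for y v
    proof -
      show *: "0 \<le> (u - v) (x - y)" using rel that by (simp add: graph_of_def)
      have "(v - u) (y - x) = (u - v) (x - y)" by (simp add: blinfun.bilinear_simps)
      with * show "0 \<le> (v - u) (y - x)" by simp
    qed
    have "0 \<le> (p - q) (a - b)" if pq: "p \<in> S a" "q \<in> S b" for a p b q
    proof -
      consider "p \<in> T a" "q \<in> T b" | "p \<in> T a" "b = x" "q = u" | "a = x" "p = u" "q \<in> T b"
        | "a = x" "p = u" "b = x" "q = u"
        using pq by (auto simp: S_def split: if_splits)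
      then show ?thesis
      proof cases
        case 1
        then show ?thesis using mono[unfolded monotone_operator_iff, rule_format, of p a q b] by simp
      next
        case 2
        then show ?thesis using rel'(2) by simp
      next
        case 3
        then show ?thesis using rel'(1) by simp
      qed simp
    qed
    then have "monotone_operator S" unfolding monotone_operator_iff by simp
    moreover have "graph_of T \<subseteq> graph_of S" by (auto simp: graph_of_def S_def)
    ultimately have "graph_of S = graph_of T"
      using max unfolding maximal_monotone_operator_def by (metis psubsetI)
    moreover have "(x, u) \<in> graph_of S" by (simp add: graph_of_def S_def)
    ultimately show "(x, u) \<in> graph_of T" by simp
  qed
next
  assume max: "maxmono (graph_of T)"
  have "monotone_operator T"
    unfolding monotone_operator_iff
    using maxmono_monotone[OF max] by (simp add: graph_of_def)
  moreover have "graph_of S \<subseteq> graph_of T" if S: "monotone_operator S" "graph_of T \<subset> graph_of S" for S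
  proof clarify
    fix x u assume xu: "(x, u) \<in> graph_of S"
    show "(x, u) \<in> graph_of T"
    proof (rule maxmono_maximal[OF max])
      fix y v assume "(y, v) \<in> graph_of T"
      then have "(y, v) \<in> graph_of S" using S(2) by blast
      then show "0 \<le> (u - v) (x - y)"
        using xu S(1)[unfolded monotone_operator_iff, rule_format, of u x v y] by (simp add: graph_of_def)
    qed
  qed
  ultimately show "maximal_monotone_operator T" unfolding maximal_monotone_operator_def by blast
qed

subsection \<open>Representative functions\<close>

text \<open>Real levels suffice because a real number fits strictly between any two comparable
  extended reals. The liminf ignores p itself, so p is put back by hand.\<close>

lemma lower_semicontinuous_iff:
  "lower_semicontinuous h \<longleftrightarrow> (\<forall>r::real. closed {p. h p \<le> ereal r})"
proof
  assume lsc: "lower_semicontinuous h"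
  show "\<forall>r::real. closed {p. h p \<le> ereal r}"
  proof
    fix r :: real
    have "open {p. ereal r < h p}"
    proof (subst open_subopen, clarify)
      fix p assume p: "ereal r < h p"
      then have "ereal r < Liminf (at p) h"
        using lsc unfolding lower_semicontinuous_def by (meson less_le_trans)
      then have "\<forall>\<^sub>F z in at p. ereal r < h z" by (rule less_LiminfD)
      then obtain S where "open S" "p \<in> S" "\<forall>z\<in>S. z \<noteq> p \<longrightarrow> ereal r < h z"
        unfolding eventually_at_topological by auto
      with p show "\<exists>T. open T \<and> p \<in> T \<and> T \<subseteq> {p. ereal r < h p}" by (intro exI[of _ S]) auto
    qed
    moreover have "- {p. h p \<le> ereal r} = {p. ereal r < h p}" by auto
    ultimately show "closed {p. h p \<le> ereal r}" by (simp add: closed_def)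
  qed
next
  assume cl: "\<forall>r::real. closed {p. h p \<le> ereal r}"
  show "lower_semicontinuous h"
    unfolding lower_semicontinuous_def le_Liminf_iff
  proof (intro allI impI)
    fix p y assume "y < h p"
    then obtain r where r: "y < ereal r" "ereal r < h p" using ereal_dense2 by blast
    have "open (- {p. h p \<le> ereal r})" using cl by (simp add: open_Compl)
    moreover have "p \<in> - {p. h p \<le> ereal r}" using r by simp
    ultimately show "\<forall>\<^sub>F z in at p. y < h z"
      unfolding eventually_at_topological using r(1) by (intro exI[of _ "- {p. h p \<le> ereal r}"]) auto
  qed
qed

lemma convex_erealD:
  assumes "convex_ereal h" "0 < t" "t < 1" "h p \<le> ereal r" "h q \<le> ereal s"
  shows "h ((1 - t) *\<^sub>R p + t *\<^sub>R q) \<le> ereal ((1 - t) * r + t * s)"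
proof -
  have "h ((1 - t) *\<^sub>R p + t *\<^sub>R q) \<le> ereal (1 - t) * h p + ereal t * h q"
    using assms(1-3) unfolding convex_ereal_def by blast
  also have "\<dots> \<le> ereal (1 - t) * ereal r + ereal t * ereal s"
    using assms by (intro add_mono ereal_mult_left_mono) auto
  finally show ?thesis by simp
qed

lemma convex_erealI:
  assumes nminf: "\<And>p. h p \<noteq> - \<infinity>"
    and le: "\<And>p q t r s. 0 < t \<Longrightarrow> t < 1 \<Longrightarrow> h p = ereal r \<Longrightarrow> h q = ereal s \<Longrightarrow>
      h ((1 - t) *\<^sub>R p + t *\<^sub>R q) \<le> ereal ((1 - t) * r + t * s)"
  shows "convex_ereal h"
  unfolding convex_ereal_def
proof (intro allI impI)
  fix p q and t :: real assume t: "0 < t" "t < 1"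
  show "h ((1 - t) *\<^sub>R p + t *\<^sub>R q) \<le> ereal (1 - t) * h p + ereal t * h q"
  proof (cases "h p = \<infinity> \<or> h q = \<infinity>")
    case True
    then have eq: "ereal (1 - t) * h p + ereal t * h q = \<infinity>"
      using t nminf[of p] nminf[of q] by (cases "h p"; cases "h q") auto
    show ?thesis unfolding eq by simp
  next
    case False
    then obtain r s where "h p = ereal r" "h q = ereal s"
      using nminf[of p] nminf[of q] by (cases "h p"; cases "h q") auto
    then show ?thesis using le[OF t] by simp
  qed
qed

lemma sublevel_sum_iff:
  fixes a b :: ereal
  assumes "a \<noteq> - \<infinity>" "b \<noteq> - \<infinity>"
  shows "a + b \<le> ereal c \<longleftrightarrow> (\<exists>r s. a = ereal r \<and> b = ereal s \<and> r + s \<le> c)"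
  using assms by (cases a; cases b) auto

lemma closed_sublevel_sum:
  fixes f g :: "'b::topological_space \<Rightarrow> ereal"
  assumes f: "\<And>r. closed {z. f z \<le> ereal r}" and g: "\<And>r. closed {z. g z \<le> ereal r}"
    and nminf: "\<And>z. f z \<noteq> - \<infinity>" "\<And>z. g z \<noteq> - \<infinity>"
  shows "closed {z. f z + g z \<le> ereal c}"
proof -
  have "open {z. ereal c < f z + g z}"
  proof (subst open_subopen, clarify)
    fix z assume z: "ereal c < f z + g z"
    \<comment> \<open>The excess over c is split into strict lower bounds for f and g separately;
      both persist on a neighbourhood.\<close>
    have "\<exists>p q. ereal p < f z \<and> ereal q < g z \<and> c < p + q"
    proof (cases "f z" rule: ereal_cases)
      case (real a)
      have "ereal (c - a) < g z" using z nminf(2)[of z] by (cases "g z") (auto simp: real)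
      then obtain q where q: "ereal (c - a) < ereal q" "ereal q < g z" using ereal_dense2 by blast
      then have "c - q < a" by simp
      then obtain p where "c - q < p" "p < a" using dense by blast
      then show ?thesis using q by (intro exI[of _ p] exI[of _ q]) (auto simp: real)
    next
      case PInf
      obtain q where "ereal q < g z"
        using nminf(2)[of z] ereal_dense2[of "- \<infinity>" "g z"] by (auto simp: less_le)
      then show ?thesis by (intro exI[of _ "c - q + 1"] exI[of _ q]) (simp add: PInf)
    next
      case MInf
      then show ?thesis using nminf by simp
    qed
    then obtain p q where pq: "ereal p < f z" "ereal q < g z" "c < p + q" by blast
    define T where "T = - {z. f z \<le> ereal p} \<inter> - {z. g z \<le> ereal q}"
    have "open T" using f g by (auto simp: T_def)
    moreover have "z \<in> T" using pq by (simp add: T_def not_le)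
    moreover have "T \<subseteq> {z. ereal c < f z + g z}"
    proof
      fix y assume "y \<in> T"
      then have "ereal p < f y" "ereal q < g y" by (auto simp: T_def)
      then have "ereal (p + q) < f y + g y" by (cases "f y"; cases "g y") auto
      moreover have "ereal c < ereal (p + q)" using pq(3) by simp
      ultimately show "y \<in> {z. ereal c < f z + g z}" using less_trans by blast
    qed
    ultimately show "\<exists>T. open T \<and> z \<in> T \<and> T \<subseteq> {z. ereal c < f z + g z}" by blast
  qed
  moreover have "- {z. f z + g z \<le> ereal c} = {z. ereal c < f z + g z}" by auto
  ultimately show ?thesis by (simp add: closed_def)
qed

lemma representative_ge: "representative_function T f \<Longrightarrow> ereal (blinfun_apply u x) \<le> f (x, u)"
  by (simp add: representative_function_def)

lemma representative_nminf: "representative_function T f \<Longrightarrow> f p \<noteq> - \<infinity>"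
  using representative_ge[of T f "snd p" "fst p"] by auto

lemma representative_eq:
  "representative_function T f \<Longrightarrow> (x, u) \<in> graph_of T \<Longrightarrow> f (x, u) = ereal (blinfun_apply u x)"
  unfolding representative_function_def by blast

text \<open>Compare \<open>f\<close> with the
  duality product along the segment from a graph point to \<open>(x, u)\<close>, to first order at the graph point.\<close>

lemma representative_fitz_le:
  assumes f: "representative_function T f" and le: "f (x, u) \<le> ereal r"
  shows "fitz_le (graph_of T) x u r"
proof (rule fitz_leI)
  fix y v assume yv: "(y, v) \<in> graph_of T"
  define A where "A = v x + u y - v y"
  have "A - r \<le> 0"
  proof (rule linear_growth_bound)
    fix \<sigma> :: real assume \<sigma>: "\<sigma> > 0"
    \<comment> \<open>\<sigma> is the ratio (1 - t) / t, so letting \<sigma> grow moves the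
      comparison point towards (y, v).\<close>
    define t where "t = 1 / (1 + \<sigma>)"
    have t: "0 < t" "t < 1" using \<sigma> by (auto simp: t_def)
    have "ereal (((1 - t) *\<^sub>R v + t *\<^sub>R u) ((1 - t) *\<^sub>R y + t *\<^sub>R x)) \<le> f ((1 - t) *\<^sub>R (y, v) + t *\<^sub>R (x, u))"
      using representative_ge[OF f] by simp
    also have "\<dots> \<le> ereal ((1 - t) * v y + t * r)"
      using f representative_eq[OF f yv] le t
      by (intro convex_erealD) (auto simp: representative_function_def)
    finally have "((1 - t) *\<^sub>R v + t *\<^sub>R u) ((1 - t) *\<^sub>R y + t *\<^sub>R x) \<le> (1 - t) * v y + t * r" by simp
    then have "t * ((1 - t) * A + t * u x) \<le> t * r"
      by (simp add: A_def blinfun.bilinear_simps algebra_simps)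
    then have "(1 - t) * A + t * u x \<le> r" using t by simp
    then have "(1 + \<sigma>) * ((1 - t) * A + t * u x) \<le> (1 + \<sigma>) * r"
      using \<sigma> by (intro mult_left_mono) auto
    moreover have "(1 + \<sigma>) * t = 1" using \<sigma> by (simp add: t_def)
    then have "(1 + \<sigma>) * ((1 - t) * A + t * u x) = \<sigma> * A + u x"
      by (simp add: distrib_left right_diff_distrib mult.assoc[symmetric])
    ultimately show "\<sigma> * (A - r) \<le> r - u x" by (simp add: algebra_simps)
  qed
  then show "v x + u y - v y \<le> r" by (simp add: A_def)
qed

text \<open>Along the line of graph points f is affine with slope z a. Mixing (x, u) with the graph
  point at parameter 1 / t, with weight t tending to 0, moves u by exactly z in the limit; lower
  semicontinuity transfers the slope.\<close>

lemma representative_recession: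
  fixes z :: "'a::real_normed_vector \<Rightarrow>\<^sub>L real"
  assumes f: "representative_function T f" and line: "\<And>\<tau>. (a, s + \<tau> *\<^sub>R z) \<in> graph_of T"
    and le: "f (x, u) \<le> ereal r"
  shows "f (x, u + z) \<le> ereal (r + z a)"
proof (rule ereal_le_epsilon2)
  fix \<epsilon> :: real assume \<epsilon>: "\<epsilon> > 0"
  \<comment> \<open>Starting at 1 / 2 rather than 1 keeps every weight strictly below 1, as
    \<open>convex_erealD\<close> demands.\<close>
  define t where "t n = inverse (real (Suc (Suc n)))" for n
  have t: "0 < t n" "t n < 1" for n by (auto simp: t_def inverse_less_1_iff)
  have t0: "t \<longlonglongrightarrow> 0"
    unfolding t_def using LIMSEQ_Suc[OF LIMSEQ_inverse_real_of_nat] by simp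
  define p where "p n = (1 - t n) *\<^sub>R (x, u) + t n *\<^sub>R (a, s + inverse (t n) *\<^sub>R z)" for n
  have p: "p n = ((1 - t n) *\<^sub>R x + t n *\<^sub>R a, (1 - t n) *\<^sub>R u + t n *\<^sub>R s + z)" for n
    using t(1)[of n] by (simp add: p_def scaleR_add_right)
  have fp: "f (p n) \<le> ereal ((1 - t n) * r + t n * s a + z a)" for n
  proof -
    have "f (p n) \<le> ereal ((1 - t n) * r + t n * (s + inverse (t n) *\<^sub>R z) a)"
      unfolding p_def using f t[of n] le representative_eq[OF f line]
      by (intro convex_erealD) (auto simp: representative_function_def)
    also have "(1 - t n) * r + t n * (s + inverse (t n) *\<^sub>R z) a = (1 - t n) * r + t n * s a + z a"
      using t(1)[of n] by (simp add: blinfun.bilinear_simps distrib_left)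
    finally show ?thesis .
  qed
  have "(\<lambda>n. (1 - t n) * r + t n * s a + z a) \<longlonglongrightarrow> (1 - 0) * r + 0 * s a + z a"
    by (intro tendsto_intros t0)
  then have "\<forall>\<^sub>F n in sequentially. (1 - t n) * r + t n * s a + z a < r + z a + \<epsilon>"
    using \<epsilon> by (intro order_tendstoD(2)) auto
  then have ev: "\<forall>\<^sub>F n in sequentially. p n \<in> {q. f q \<le> ereal (r + z a + \<epsilon>)}"
  proof (rule eventually_mono)
    fix n assume "(1 - t n) * r + t n * s a + z a < r + z a + \<epsilon>"
    then have "ereal ((1 - t n) * r + t n * s a + z a) \<le> ereal (r + z a + \<epsilon>)" by simp
    with fp[of n] show "p n \<in> {q. f q \<le> ereal (r + z a + \<epsilon>)}" using order_trans by blast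
  qed
  have "p \<longlonglongrightarrow> ((1 - 0) *\<^sub>R x + 0 *\<^sub>R a, (1 - 0) *\<^sub>R u + 0 *\<^sub>R s + z)"
    unfolding p by (intro tendsto_intros t0)
  then have lim: "p \<longlonglongrightarrow> (x, u + z)" by simp
  have "closed {q. f q \<le> ereal (r + z a + \<epsilon>)}"
    using f lower_semicontinuous_iff unfolding representative_function_def by blast
  from Lim_in_closed_set[OF this ev _ lim]
  show "f (x, u + z) \<le> ereal (r + z a) + ereal \<epsilon>" by simp
qed

subsection \<open>The partial infimal convolution\<close>

lemma inf_conv2_le_iff:
  assumes "\<And>p. f p \<noteq> - \<infinity>" "\<And>p. g p \<noteq> - \<infinity>"
  shows "inf_conv2 f g (x, u) \<le> ereal r \<longleftrightarrow>
    (\<forall>\<epsilon>>0. \<exists>w a b. f (x, w) = ereal a \<and> g (x, u - w) = ereal b \<and> a + b \<le> r + \<epsilon>)"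
proof
  assume le: "inf_conv2 f g (x, u) \<le> ereal r"
  show "\<forall>\<epsilon>>0. \<exists>w a b. f (x, w) = ereal a \<and> g (x, u - w) = ereal b \<and> a + b \<le> r + \<epsilon>"
  proof (intro allI impI)
    fix \<epsilon> :: real assume "\<epsilon> > 0"
    then have "ereal r < ereal (r + \<epsilon>)" by simp
    with le have "(INF w. f (x, w) + g (x, u - w)) < ereal (r + \<epsilon>)"
      unfolding inf_conv2_def by (simp add: le_less_trans)
    then obtain w where "f (x, w) + g (x, u - w) < ereal (r + \<epsilon>)" by (auto simp: INF_less_iff)
    then have "f (x, w) + g (x, u - w) \<le> ereal (r + \<epsilon>)" by (rule less_imp_le)
    then show "\<exists>w a b. f (x, w) = ereal a \<and> g (x, u - w) = ereal b \<and> a + b \<le> r + \<epsilon>"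
      unfolding sublevel_sum_iff[OF assms] by blast
  qed
next
  assume *: "\<forall>\<epsilon>>0. \<exists>w a b. f (x, w) = ereal a \<and> g (x, u - w) = ereal b \<and> a + b \<le> r + \<epsilon>"
  show "inf_conv2 f g (x, u) \<le> ereal r"
  proof (rule ereal_le_epsilon2)
    fix \<epsilon> :: real assume "\<epsilon> > 0"
    then obtain w a b where w: "f (x, w) = ereal a" "g (x, u - w) = ereal b" "a + b \<le> r + \<epsilon>" using * by blast
    have "inf_conv2 f g (x, u) \<le> f (x, w) + g (x, u - w)"
      unfolding inf_conv2_def by (auto intro: INF_lower)
    also have "\<dots> \<le> ereal r + ereal \<epsilon>" using w by simp
    finally show "inf_conv2 f g (x, u) \<le> ereal r + ereal \<epsilon>" .
  qed
qed

lemma inf_conv2_ge: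
  fixes u :: "'a::real_normed_vector \<Rightarrow>\<^sub>L real"
  assumes f: "representative_function S f" and g: "representative_function T g"
  shows "ereal (blinfun_apply u x) \<le> inf_conv2 f g (x, u)"
  unfolding inf_conv2_def prod.case
proof (rule INF_greatest)
  fix w :: "'a \<Rightarrow>\<^sub>L real"
  have "ereal (w x) + ereal ((u - w) x) \<le> f (x, w) + g (x, u - w)"
    by (intro add_mono representative_ge[OF f] representative_ge[OF g])
  then show "ereal (u x) \<le> f (x, w) + g (x, u - w)" by (simp add: blinfun.diff_left)
qed

lemma inf_conv2_convex:
  assumes f: "representative_function S f" and g: "representative_function T g"
  shows "convex_ereal (inf_conv2 f g)"
proof (rule convex_erealI)
  have nminf: "\<And>p. f p \<noteq> - \<infinity>" "\<And>p. g p \<noteq> - \<infinity>"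
    using representative_nminf f g by blast+
  note iff = inf_conv2_le_iff[of f g, OF nminf]
  fix p show "inf_conv2 f g p \<noteq> - \<infinity>"
    using inf_conv2_ge[OF f g, of "snd p" "fst p"] by auto
  fix p q and t r s :: real
  assume t: "0 < t" "t < 1" and p: "inf_conv2 f g p = ereal r" and q: "inf_conv2 f g q = ereal s"
  obtain x u y v where pq: "p = (x, u)" "q = (y, v)" by (metis surj_pair)
  have "inf_conv2 f g ((1 - t) *\<^sub>R x + t *\<^sub>R y, (1 - t) *\<^sub>R u + t *\<^sub>R v) \<le> ereal ((1 - t) * r + t * s)"
    unfolding iff
  proof (intro allI impI)
    fix \<epsilon> :: real assume \<epsilon>: "\<epsilon> > 0"
    obtain w1 a1 b1 where 1: "f (x, w1) = ereal a1" "g (x, u - w1) = ereal b1" "a1 + b1 \<le> r + \<epsilon>"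
      using p \<epsilon> iff[of x u r] by (auto simp: pq)
    obtain w2 a2 b2 where 2: "f (y, w2) = ereal a2" "g (y, v - w2) = ereal b2" "a2 + b2 \<le> s + \<epsilon>"
      using q \<epsilon> iff[of y v s] by (auto simp: pq)
    define w where "w = (1 - t) *\<^sub>R w1 + t *\<^sub>R w2"
    let ?x = "(1 - t) *\<^sub>R x + t *\<^sub>R y" and ?u = "(1 - t) *\<^sub>R u + t *\<^sub>R v"
    have "f (?x, w) \<le> ereal ((1 - t) * a1 + t * a2)"
      using f convex_erealD[of f t "(x, w1)" a1 "(y, w2)" a2] 1 2 t
      by (simp add: representative_function_def w_def)
    moreover have "g (?x, ?u - w) \<le> ereal ((1 - t) * b1 + t * b2)"
    proof -
      have "?u - w = (1 - t) *\<^sub>R (u - w1) + t *\<^sub>R (v - w2)" by (simp add: w_def algebra_simps)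
      then show ?thesis
        using g convex_erealD[of g t "(x, u - w1)" b1 "(y, v - w2)" b2] 1 2 t
        by (simp add: representative_function_def)
    qed
    ultimately have "f (?x, w) + g (?x, ?u - w) \<le> ereal ((1 - t) * a1 + t * a2) + ereal ((1 - t) * b1 + t * b2)"
      by (rule add_mono)
    also have "\<dots> = ereal ((1 - t) * (a1 + b1) + t * (a2 + b2))" by (simp add: algebra_simps)
    also have "\<dots> \<le> ereal ((1 - t) * r + t * s + \<epsilon>)"
    proof -
      have "(1 - t) * (a1 + b1) + t * (a2 + b2) \<le> (1 - t) * (r + \<epsilon>) + t * (s + \<epsilon>)"
        using 1(3) 2(3) t by (intro add_mono[OF mult_left_mono mult_left_mono]) auto
      then show ?thesis by (simp add: algebra_simps)
    qed
    finally show "\<exists>w a b. f (?x, w) = ereal a \<and> g (?x, ?u - w) = ereal b \<and> a + b \<le> (1 - t) * r + t * s + \<epsilon>"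
      unfolding sublevel_sum_iff[OF representative_nminf[OF f] representative_nminf[OF g]] by blast
  qed
  then show "inf_conv2 f g ((1 - t) *\<^sub>R p + t *\<^sub>R q) \<le> ereal ((1 - t) * r + t * s)" by (simp add: pq)
qed

text \<open>Near-minimisers w n are bounded only on Y. Replacing them by norm-bounded extensions
  changes them by annihilators of Y, whose effect on f and g is controlled by
  \<open>representative_recession\<close>.\<close>

lemma inf_conv2_lower_semicontinuous:
  fixes S T :: "'a::banach \<Rightarrow> ('a \<Rightarrow>\<^sub>L real) set"
  assumes refl: "reflexive_space TYPE('a)"
    and M: "maxmono (graph_of S)" and N: "maxmono (graph_of T)"
    and f: "representative_function S f" and g: "representative_function T g"
    and Y: "closed Y" "subspace Y"
    and MN: "\<And>a s b t. (a, s) \<in> graph_of S \<Longrightarrow> (b, t) \<in> graph_of T \<Longrightarrow> a - b \<in> Y"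
    and dom: "\<And>y. y \<in> Y \<Longrightarrow>
      \<exists>\<tau>>0. \<exists>a s b t. \<tau> *\<^sub>R y = a - b \<and> (a, s) \<in> graph_of S \<and> (b, t) \<in> graph_of T"
  shows "lower_semicontinuous (inf_conv2 f g)"
  unfolding lower_semicontinuous_iff closed_sequential_limits
proof (intro allI impI, elim conjE)
  fix r :: real and p :: "nat \<Rightarrow> 'a \<times> ('a \<Rightarrow>\<^sub>L real)" and l
  have nminf: "\<And>p. f p \<noteq> - \<infinity>" "\<And>p. g p \<noteq> - \<infinity>"
    using representative_nminf f g by blast+
  note iff = inf_conv2_le_iff[of f g, OF nminf]
  assume p: "\<forall>n. p n \<in> {q. inf_conv2 f g q \<le> ereal r}" and lim: "p \<longlonglongrightarrow> l"
  define x u where "x n = fst (p n)" and "u n = snd (p n)" for n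
  obtain x0 u0 where l: "l = (x0, u0)" by (metis surj_pair)
  have xlim: "x \<longlonglongrightarrow> x0" and ulim: "u \<longlonglongrightarrow> u0"
    using tendsto_fst[OF lim] tendsto_snd[OF lim] by (simp_all add: x_def[abs_def] u_def[abs_def] l)
  obtain Bx Bu where Bx: "\<And>n. norm (x n) \<le> Bx" and Bu: "\<And>n. norm (u n) \<le> Bu"
    using convergentI[OF xlim] convergentI[OF ulim] by (meson Bseq_def convergent_imp_Bseq)
  have Bx0: "0 \<le> Bx" and Bu0: "0 \<le> Bu"
    using order_trans[OF norm_ge_zero Bx] order_trans[OF norm_ge_zero Bu] by blast+
  \<comment> \<open>A common domain point: the recession slopes of f and g can then be evaluated at
    the same c.\<close>
  obtain c sc tc where c: "(c, sc) \<in> graph_of S" "(c, tc) \<in> graph_of T"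
    using dom[OF subspace_0[OF Y(2)]] by auto
  have "inf_conv2 f g (x0, u0) \<le> ereal r"
  proof (rule ereal_le_epsilon2)
    fix \<epsilon> :: real assume \<epsilon>: "\<epsilon> > 0"
    have "\<exists>w a b. f (x n, w) = ereal a \<and> g (x n, u n - w) = ereal b \<and> a + b \<le> r + \<epsilon>" for n
      using p iff[of "x n" "u n" r] \<epsilon> by (simp add: x_def u_def)
    then obtain w \<alpha> \<beta> where w: "\<And>n. f (x n, w n) = ereal (\<alpha> n)" "\<And>n. g (x n, u n - w n) = ereal (\<beta> n)"
      "\<And>n. \<alpha> n + \<beta> n \<le> r + \<epsilon>" by metis
    have upper: "\<exists>B. \<forall>n. w n y \<le> B" if y: "y \<in> Y" for y
    proof -
      obtain \<tau> a s b t where *: "\<tau> > 0" "\<tau> *\<^sub>R y = a - b" "(a, s) \<in> graph_of S" "(b, t) \<in> graph_of T"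
        using dom[OF y] by blast
      define B where "B = r + \<epsilon> + s a + t b + norm s * Bx + norm t * Bx + Bu * norm b"
      have "\<tau> * w n y \<le> B" for n
      proof -
        have "s (x n) + w n a - s a \<le> \<alpha> n" "t (x n) + (u n - w n) b - t b \<le> \<beta> n"
          using fitz_leD[OF representative_fitz_le[OF f eq_refl[OF w(1)]] *(3)]
            fitz_leD[OF representative_fitz_le[OF g eq_refl[OF w(2)]] *(4)] by auto
        moreover have "\<tau> * w n y = w n a - w n b"
          using *(2) by (metis blinfun.diff_right blinfun.scaleR_right real_scaleR_def)
        ultimately have "\<tau> * w n y \<le> r + \<epsilon> + s a + t b - s (x n) - t (x n) - u n b"
          using w(3)[of n] by (simp add: blinfun.diff_left)
        also have "\<dots> \<le> r + \<epsilon> + s a + t b + norm s * norm (x n) + norm t * norm (x n) + norm (u n) * norm b"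
          using norm_blinfun[of s "x n"] norm_blinfun[of t "x n"] norm_blinfun[of "u n" b]
          unfolding real_norm_def by linarith
        also have "\<dots> \<le> B"
          unfolding B_def by (intro add_mono mult_left_mono mult_right_mono Bx Bu order_refl norm_ge_zero)
        finally show ?thesis .
      qed
      then show ?thesis using *(1) by (intro exI[of _ "B / \<tau>"]) (simp add: field_simps)
    qed
    have "\<exists>B. \<forall>n. \<bar>w n z\<bar> \<le> B" if z: "z \<in> Y" for z
    proof -
      obtain B1 B2 where B: "\<And>n. w n z \<le> B1" "\<And>n. w n (- z) \<le> B2"
        using upper[OF z] upper[OF subspace_neg[OF Y(2) z]] by blast
      have "\<bar>w n z\<bar> \<le> max B1 B2" for n
        using B(1)[of n] B(2)[of n] by (auto simp: abs_le_iff blinfun.minus_right)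
      then show ?thesis by blast
    qed
    then obtain B where B: "B \<ge> 0" "\<And>n z. z \<in> Y \<Longrightarrow> \<bar>w n z\<bar> \<le> B * norm z"
      using uniform_boundedness_on_subspace[OF Y, of w] by blast
    have "\<exists>w' :: 'a \<Rightarrow>\<^sub>L real. (\<forall>z\<in>Y. blinfun_apply w' z = w n z) \<and> norm w' \<le> B" for n
      using B by (intro hahn_banach_extension[OF Y(2)]) (auto simp: abs_le_iff)
    then obtain w' where w': "\<And>n z. z \<in> Y \<Longrightarrow> blinfun_apply (w' n) z = w n z" "\<And>n. norm (w' n) \<le> B"
      by metis
    define z where "z n = w' n - w n" for n
    have ann: "z n y = 0" if "y \<in> Y" for n y using w'(1)[OF that] by (simp add: z_def blinfun.diff_left)
    have lineS: "(c, sc + \<tau> *\<^sub>R z n) \<in> graph_of S" for \<tau> n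
    proof (rule maxmono_add_annihilator[OF M c(1)])
      fix y v assume "(y, v) \<in> graph_of S"
      then have "c - y \<in> Y"
        using subspace_neg[OF Y(2) MN[OF _ c(2)]] by (metis minus_diff_eq)
      then show "(\<tau> *\<^sub>R z n) (c - y) = 0" using ann by (simp add: blinfun.scaleR_left)
    qed
    have lineT: "(c, tc + \<tau> *\<^sub>R (- z n)) \<in> graph_of T" for \<tau> n
    proof (rule maxmono_add_annihilator[OF N c(2)])
      fix y v assume "(y, v) \<in> graph_of T"
      then have "c - y \<in> Y" using MN[OF c(1)] by blast
      then show "(\<tau> *\<^sub>R (- z n)) (c - y) = 0" using ann by (simp add: blinfun.scaleR_left blinfun.minus_left)
    qed
    \<comment> \<open>f gains at most z n c and g loses the same amount, so the bound on the sum
      survives.\<close>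
    have f': "f (x n, w' n) \<le> ereal (\<alpha> n + z n c)" for n
      using representative_recession[OF f lineS eq_refl[OF w(1)], of n n] by (simp add: z_def)
    have g': "g (x n, u n - w' n) \<le> ereal (\<beta> n - z n c)" for n
      using representative_recession[OF g lineT eq_refl[OF w(2)], of n n]
      by (simp add: z_def blinfun.bilinear_simps algebra_simps)
    \<comment> \<open>The argument of g is a component of its own, so that K does not depend on n;
      that the two functionals add up to u0 is recovered from a linear limit.\<close>
    define e where "e n = (x n, w' n, u n - w' n)" for n
    define K where "K = {q :: 'a \<times> ('a \<Rightarrow>\<^sub>L real) \<times> ('a \<Rightarrow>\<^sub>L real).
      f (fst q, fst (snd q)) + g (fst q, snd (snd q)) \<le> ereal (r + \<epsilon>)}"
    have eK: "e n \<in> K" for n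
    proof -
      have "f (x n, w' n) + g (x n, u n - w' n) \<le> ereal (\<alpha> n + z n c) + ereal (\<beta> n - z n c)"
        by (intro add_mono f' g')
      also have "\<dots> \<le> ereal (r + \<epsilon>)" using w(3)[of n] by simp
      finally show ?thesis by (simp add: K_def e_def)
    qed
    have clK: "closed K"
      unfolding K_def
    proof (rule closed_sublevel_sum)
      have cf: "closed {q. f q \<le> ereal a}" and cg: "closed {q. g q \<le> ereal a}" for a
        using f g lower_semicontinuous_iff unfolding representative_function_def by blast+
      show "closed {q. f (fst q, fst (snd q)) \<le> ereal a}" for a
        using closed_vimage[OF cf[of a], of "\<lambda>q. (fst q, fst (snd q))"]
        by (simp add: vimage_def continuous_intros)
      show "closed {q. g (fst q, snd (snd q)) \<le> ereal a}" for a
        using closed_vimage[OF cg[of a], of "\<lambda>q. (fst q, snd (snd q))"]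
        by (simp add: vimage_def continuous_intros)
    qed (use nminf in auto)
    have cvK: "convex K"
      unfolding convex_alt
    proof (intro ballI allI impI)
      fix q q' and t :: real assume q: "q \<in> K" "q' \<in> K" and "0 \<le> t \<and> t \<le> 1"
      then consider "t = 0" | "t = 1" | "0 < t" "t < 1" by linarith
      then show "(1 - t) *\<^sub>R q + t *\<^sub>R q' \<in> K"
      proof cases
        case 3
        obtain y v v' where qq: "q = (y, v, v')" by (metis surj_pair)
        obtain y1 v1 v1' where qq': "q' = (y1, v1, v1')" by (metis surj_pair)
        obtain a b where 1: "f (y, v) = ereal a" "g (y, v') = ereal b" "a + b \<le> r + \<epsilon>"
          using q(1) by (auto simp: K_def qq sublevel_sum_iff nminf)
        obtain a1 b1 where 2: "f (y1, v1) = ereal a1" "g (y1, v1') = ereal b1" "a1 + b1 \<le> r + \<epsilon>"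
          using q(2) by (auto simp: K_def qq' sublevel_sum_iff nminf)
        have "f ((1 - t) *\<^sub>R (y, v) + t *\<^sub>R (y1, v1)) + g ((1 - t) *\<^sub>R (y, v') + t *\<^sub>R (y1, v1'))
            \<le> ereal ((1 - t) * a + t * a1) + ereal ((1 - t) * b + t * b1)"
          using f g 3 1 2 by (intro add_mono convex_erealD) (auto simp: representative_function_def)
        also have "\<dots> = ereal ((1 - t) * (a + b) + t * (a1 + b1))" by (simp add: algebra_simps)
        also have "\<dots> \<le> ereal ((1 - t) * (r + \<epsilon>) + t * (r + \<epsilon>))"
          using 1(3) 2(3) 3 unfolding ereal_less_eq
          by (intro add_mono[OF mult_left_mono mult_left_mono]) auto
        also have "(1 - t) * (r + \<epsilon>) + t * (r + \<epsilon>) = r + \<epsilon>" by (simp add: algebra_simps)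
        finally show ?thesis by (simp add: K_def qq qq')
      qed (use q in auto)
    qed
    have "norm (e n) \<le> Bx + (B + (Bu + B))" for n
      unfolding e_def
      using Bx[of n] w'(2)[of n] Bu[of n] norm_triangle_ineq4[of "u n" "w' n"]
        norm_Pair_le[of "x n" "(w' n, u n - w' n)"] norm_Pair_le[of "w' n" "u n - w' n"] by linarith
    moreover have "reflexive_space TYPE('a \<times> ('a \<Rightarrow>\<^sub>L real) \<times> ('a \<Rightarrow>\<^sub>L real))"
      by (intro reflexive_prod reflexive_dual refl)
    ultimately obtain e0 where e0: "\<And>K. closed K \<Longrightarrow> convex K \<Longrightarrow> (\<forall>\<^sub>F n in sequentially. e n \<in> K) \<Longrightarrow> e0 \<in> K"
      using reflexive_weak_cluster by metis
    have "(\<lambda>n. fst (e n)) \<longlonglongrightarrow> x0" "(\<lambda>n. fst (snd (e n)) + snd (snd (e n))) \<longlonglongrightarrow> u0"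
      using xlim ulim by (simp_all add: e_def)
    from weak_cluster_limit[OF e0 bounded_linear_fst this(1)]
      weak_cluster_limit[OF e0 bounded_linear_add[OF
          bounded_linear_compose[OF bounded_linear_fst bounded_linear_snd]
          bounded_linear_compose[OF bounded_linear_snd bounded_linear_snd]] this(2)]
    have "fst e0 = x0" "fst (snd e0) + snd (snd e0) = u0" by blast+
    moreover have "e0 \<in> K" using eK by (intro e0 clK cvK always_eventually) blast
    ultimately have "f (x0, fst (snd e0)) + g (x0, u0 - fst (snd e0)) \<le> ereal (r + \<epsilon>)"
      by (auto simp: K_def)
    moreover have "inf_conv2 f g (x0, u0) \<le> f (x0, fst (snd e0)) + g (x0, u0 - fst (snd e0))"
      unfolding inf_conv2_def prod.case by (rule INF_lower) simp
    ultimately show "inf_conv2 f g (x0, u0) \<le> ereal r + ereal \<epsilon>" using order_trans by fastforce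
  qed
  then show "l \<in> {q. inf_conv2 f g q \<le> ereal r}" by (simp add: l)
qed

subsection \<open>The strong quasi-relative interior condition\<close>

lemma zero_in_sqri_iff:
  "0 \<in> sqri U \<longleftrightarrow> 0 \<in> U \<and> closed (cone hull U) \<and> subspace (cone hull U)"
  by (simp add: sqri_def)

lemma minkowski_diffI: "a \<in> A \<Longrightarrow> b \<in> B \<Longrightarrow> a - b \<in> minkowski_diff A B"
  unfolding minkowski_diff_def by blast

lemma minkowski_diffE:
  assumes "v \<in> minkowski_diff A B"
  obtains a b where "v = a - b" "a \<in> A" "b \<in> B"
  using assms unfolding minkowski_diff_def by blast

lemma minkowski_diff_mono: "A \<subseteq> C \<Longrightarrow> B \<subseteq> D \<Longrightarrow> minkowski_diff A B \<subseteq> minkowski_diff C D"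
  unfolding minkowski_diff_def by blast

text \<open>The multiple 0 is the case that needs 0 \<in> U; otherwise the cone coefficient is
  inverted.\<close>

lemma cone_hull_scale_into:
  assumes "0 \<in> U" "y \<in> cone hull U"
  shows "\<exists>\<tau>>0. \<tau> *\<^sub>R y \<in> U"
proof -
  obtain c x where cx: "y = c *\<^sub>R x" "0 \<le> c" "x \<in> U"
    using assms(2) unfolding cone_hull_expl by blast
  show ?thesis
  proof (cases "c = 0")
    case True
    then show ?thesis using cx assms(1) by (intro exI[of _ 1]) simp
  next
    case False
    then show ?thesis using cx by (intro exI[of _ "inverse c"]) simp
  qed
qed

lemma representative_domain:
  assumes f: "representative_function T f" and x: "x \<in> fst ` effective_domain f"
  shows "\<exists>u r. fitz_le (graph_of T) x u r"
proof -
  obtain u where "f (x, u) < \<infinity>" using x by (auto simp: effective_domain_def)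
  then obtain r where "f (x, u) = ereal r"
    using representative_nminf[OF f, of "(x, u)"] by (cases "f (x, u)") auto
  then show ?thesis using representative_fitz_le[OF f, of x u r] by auto
qed

lemma op_domain_subset_representative_domain:
  assumes "representative_function T f"
  shows "op_domain T \<subseteq> fst ` effective_domain f"
proof
  fix x assume "x \<in> op_domain T"
  then obtain u where "(x, u) \<in> graph_of T" by (auto simp: op_domain_def graph_of_def)
  then have "(x, u) \<in> effective_domain f"
    using representative_eq[OF assms] by (simp add: effective_domain_def)
  then show "x \<in> fst ` effective_domain f" by (rule image_eqI[rotated]) simp
qed

lemma graph_in_op_domain: "(x, u) \<in> graph_of T \<Longrightarrow> x \<in> op_domain T"
  by (auto simp: op_domain_def graph_of_def)

lemma op_domain_iff: "x \<in> op_domain T \<longleftrightarrow> (\<exists>u. (x, u) \<in> graph_of T)"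
  by (auto simp: op_domain_def graph_of_def)

text \<open>\<open>fitz_domain_affine\<close> keeps the larger difference set inside the closed
  subspace spanned by the smaller one, so both have the same conical hull.\<close>

lemma sqri_op_domain_imp_representative_domain:
  fixes S T :: "'a::real_normed_vector \<Rightarrow> ('a \<Rightarrow>\<^sub>L real) set"
  assumes M: "maxmono (graph_of S)" and N: "maxmono (graph_of T)"
    and f: "representative_function S f" and g: "representative_function T g"
    and sq: "0 \<in> sqri (minkowski_diff (op_domain S) (op_domain T))"
  shows "0 \<in> sqri (minkowski_diff (fst ` effective_domain f) (fst ` effective_domain g))"
proof -
  let ?U = "minkowski_diff (op_domain S) (op_domain T)"
  let ?V = "minkowski_diff (fst ` effective_domain f) (fst ` effective_domain g)"
  define Y where "Y = cone hull ?U"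
  have Y: "closed Y" "subspace Y" and U0: "0 \<in> ?U" using sq by (simp_all add: zero_in_sqri_iff Y_def)
  have UV: "?U \<subseteq> ?V"
    by (intro minkowski_diff_mono op_domain_subset_representative_domain f g)
  have UY: "?U \<subseteq> Y" unfolding Y_def by (rule hull_subset)
  have MN: "a - b \<in> Y" if "(a, s) \<in> graph_of S" "(b, t) \<in> graph_of T" for a s b t
    by (rule subsetD[OF UY minkowski_diffI[OF that[THEN graph_in_op_domain]]])
  obtain a0 b0 where "a0 \<in> op_domain S" "b0 \<in> op_domain T" by (rule minkowski_diffE[OF U0])
  then obtain s0 t0 where s0: "(a0, s0) \<in> graph_of S" and t0: "(b0, t0) \<in> graph_of T"
    by (auto simp: op_domain_iff)
  have MY: "a - a' \<in> Y" if "(a, s) \<in> graph_of S" "(a', s') \<in> graph_of S" for a s a' s'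
    using subspace_diff[OF Y(2) MN[OF that(1) t0] MN[OF that(2) t0]] by simp
  have NY: "b - b' \<in> Y" if "(b, t) \<in> graph_of T" "(b', t') \<in> graph_of T" for b t b' t'
    using subspace_diff[OF Y(2) MN[OF s0 that(2)] MN[OF s0 that(1)]] by simp
  have VY: "?V \<subseteq> Y"
  proof
    fix v assume "v \<in> ?V"
    then obtain x y where v: "v = x - y" and x: "x \<in> fst ` effective_domain f" and y: "y \<in> fst ` effective_domain g"
      by (rule minkowski_diffE)
    obtain p r q s where le: "fitz_le (graph_of S) x p r" "fitz_le (graph_of T) y q s"
      using representative_domain[OF f x] representative_domain[OF g y] by blast
    have x: "x - a0 \<in> Y" by (rule fitz_domain_affine[OF M Y MY s0 le(1)])
    have y: "y - b0 \<in> Y" by (rule fitz_domain_affine[OF N Y NY t0 le(2)])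
    have "(x - a0) - (y - b0) + (a0 - b0) \<in> Y"
      by (rule subspace_add[OF Y(2) subspace_diff[OF Y(2) x y] MN[OF s0 t0]])
    then show "v \<in> Y" by (simp add: v)
  qed
  have "cone Y" unfolding Y_def by (rule cone_cone_hull)
  then have "cone hull ?V = Y"
    using hull_minimal[OF VY] hull_mono[OF UV, of cone] by (auto simp: Y_def)
  then show ?thesis using Y UV U0 by (auto simp: zero_in_sqri_iff)
qed

text \<open>By \<open>sum_domain\<close>, halving maps the larger difference set into the smaller
  one. Conical hulls ignore the factor, and half of 0 is 0.\<close>

lemma sqri_representative_domain_imp_op_domain:
  fixes S T :: "'a::banach \<Rightarrow> ('a \<Rightarrow>\<^sub>L real) set"
  assumes refl: "reflexive_space TYPE('a)"
    and M: "maxmono (graph_of S)" and N: "maxmono (graph_of T)"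
    and f: "representative_function S f" and g: "representative_function T g"
    and sq: "0 \<in> sqri (minkowski_diff (fst ` effective_domain f) (fst ` effective_domain g))"
  shows "0 \<in> sqri (minkowski_diff (op_domain S) (op_domain T))"
proof -
  let ?U = "minkowski_diff (op_domain S) (op_domain T)"
  let ?V = "minkowski_diff (fst ` effective_domain f) (fst ` effective_domain g)"
  define Y where "Y = cone hull ?V"
  have Y: "closed Y" "subspace Y" and V0: "0 \<in> ?V" using sq by (simp_all add: zero_in_sqri_iff Y_def)
  have UV: "?U \<subseteq> ?V"
    by (intro minkowski_diff_mono op_domain_subset_representative_domain f g)
  have VY: "?V \<subseteq> Y" unfolding Y_def by (rule hull_subset)
  have MN: "a - b \<in> Y" if "(a, s) \<in> graph_of S" "(b, t) \<in> graph_of T" for a s b t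
    by (rule subsetD[OF VY subsetD[OF UV minkowski_diffI[OF that[THEN graph_in_op_domain]]]])
  have Vfitz: "\<exists>a s r b t q. v = a - b \<and> fitz_le (graph_of S) a s r \<and> fitz_le (graph_of T) b t q"
    if v: "v \<in> ?V" for v
  proof -
    obtain x y where xy: "v = x - y" "x \<in> fst ` effective_domain f" "y \<in> fst ` effective_domain g"
      by (rule minkowski_diffE[OF v])
    show ?thesis
      using representative_domain[OF f xy(2)] representative_domain[OF g xy(3)] xy(1) by blast
  qed
  have dom: "\<exists>\<tau>>0. \<exists>a s r b t q. \<tau> *\<^sub>R y = a - b \<and> fitz_le (graph_of S) a s r \<and> fitz_le (graph_of T) b t q"
    if y: "y \<in> Y" for y
  proof -
    obtain \<tau> where "\<tau> > 0" "\<tau> *\<^sub>R y \<in> ?V" using cone_hull_scale_into[OF V0] y by (auto simp: Y_def)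
    then show ?thesis using Vfitz[of "\<tau> *\<^sub>R y"] by blast
  qed
  have half: "(1 / 2) *\<^sub>R v \<in> ?U" if v: "v \<in> ?V" for v
  proof -
    obtain a s r b t q where *: "v = a - b" "fitz_le (graph_of S) a s r" "fitz_le (graph_of T) b t q"
      using Vfitz[OF v] by blast
    have hv: "(1 / 2) *\<^sub>R v \<in> Y" using v VY Y(2) by (auto intro: subspace_scale)
    have eq: "(1 / 2) *\<^sub>R v = (1 / 2) *\<^sub>R (a - b)" by (simp only: *(1))
    have "\<exists>x u y w. (x, u) \<in> graph_of S \<and> (y, w) \<in> graph_of T \<and> (1 / 2) *\<^sub>R v = x - y"
      by (rule sum_domain[OF refl M N Y MN dom hv *(2,3) eq])
    then obtain x u y w where "(x, u) \<in> graph_of S" "(y, w) \<in> graph_of T" "(1 / 2) *\<^sub>R v = x - y" by blast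
    then show ?thesis using minkowski_diffI[OF graph_in_op_domain graph_in_op_domain] by simp
  qed
  have "Y \<subseteq> cone hull ?U"
  proof
    fix y assume "y \<in> Y"
    then obtain \<tau> where \<tau>: "\<tau> > 0" "\<tau> *\<^sub>R y \<in> ?V" using cone_hull_scale_into[OF V0] by (auto simp: Y_def)
    have "y = (2 / \<tau>) *\<^sub>R ((1 / 2) *\<^sub>R (\<tau> *\<^sub>R y))" using \<tau>(1) by simp
    moreover have "0 \<le> 2 / \<tau>" using \<tau>(1) by simp
    ultimately show "y \<in> cone hull ?U" unfolding cone_hull_expl using half[OF \<tau>(2)] by blast
  qed
  then have "cone hull ?U = Y" using hull_mono[OF UV, of cone] by (auto simp: Y_def)
  then show ?thesis using Y half[OF V0] by (simp add: zero_in_sqri_iff)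
qed

subsection \<open>Bifunctions\<close>

lemma bifun_operator_add:
  assumes "u \<in> bifun_operator C F x" "v \<in> bifun_operator C G x"
  shows "u + v \<in> bifun_operator C (\<lambda>x y. F x y + G x y) x"
proof -
  have x: "x \<in> C" and u: "\<And>y. y \<in> C \<Longrightarrow> u (y - x) \<le> F x y - F x x"
    and v: "\<And>y. y \<in> C \<Longrightarrow> v (y - x) \<le> G x y - G x x"
    using assms by (auto simp: bifun_operator_def split: if_splits)
  have "(u + v) (y - x) \<le> F x y + G x y - (F x x + G x x)" if "y \<in> C" for y
    using u[OF that] v[OF that] by (simp add: blinfun.add_left)
  then show ?thesis using x by (simp add: bifun_operator_def)
qed

lemma monotone_bifun_operator:
  assumes "monotone_bifunction C H" "\<And>x. x \<in> C \<Longrightarrow> H x x = 0"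
  shows "monotone_operator (bifun_operator C H)"
  unfolding monotone_operator_def
proof (intro allI impI)
  fix x y u v assume u: "u \<in> bifun_operator C H x" and v: "v \<in> bifun_operator C H y"
  have xy: "x \<in> C" "y \<in> C" using u v by (auto simp: bifun_operator_def split: if_splits)
  have "u (y - x) \<le> H x y" "v (x - y) \<le> H y x"
    using u v xy assms(2) by (auto simp: bifun_operator_def)
  moreover have "H x y + H y x \<le> 0" using assms(1) xy by (simp add: monotone_bifunction_def)
  ultimately have "u (y - x) + v (x - y) \<le> 0" by linarith
  then show "0 \<le> (v - u) (y - x)" by (simp add: blinfun.bilinear_simps)
qed

text \<open>The pointwise sum is contained in the operator of F + G, and the latter is monotone.
  Since the sum already admits no further related point, the two coincide and are maximal.\<close>

lemma bifun_operator_sum: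
  fixes C :: "'a::banach set"
  assumes refl: "reflexive_space TYPE('a)"
    and F: "maximal_monotone_bifunction C F" and G: "maximal_monotone_bifunction C G"
    and diag: "\<And>x. x \<in> C \<Longrightarrow> F x x = 0 \<and> G x x = 0"
    and sq: "0 \<in> sqri (minkowski_diff (op_domain (bifun_operator C F)) (op_domain (bifun_operator C G)))"
  shows "maximal_monotone_bifunction C (\<lambda>x y. F x y + G x y)"
    and "(\<lambda>x. bifun_operator C F x + bifun_operator C G x) = bifun_operator C (\<lambda>x y. F x y + G x y)"
proof -
  let ?S = "bifun_operator C F" and ?T = "bifun_operator C G"
    and ?H = "\<lambda>x y. F x y + G x y"
  let ?U = "minkowski_diff (op_domain ?S) (op_domain ?T)"
  define Y where "Y = cone hull ?U"
  have Y: "closed Y" "subspace Y" and U0: "0 \<in> ?U" using sq by (simp_all add: zero_in_sqri_iff Y_def)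
  have M: "maxmono (graph_of ?S)" and N: "maxmono (graph_of ?T)"
    using F G by (simp_all add: maximal_monotone_bifunction_def maximal_monotone_operator_iff)
  have UY: "?U \<subseteq> Y" unfolding Y_def by (rule hull_subset)
  have MN: "a - b \<in> Y" if "(a, s) \<in> graph_of ?S" "(b, t) \<in> graph_of ?T" for a s b t
    by (rule subsetD[OF UY minkowski_diffI[OF that[THEN graph_in_op_domain]]])
  have dom: "\<exists>\<tau>>0. \<exists>a s r b t q. \<tau> *\<^sub>R y = a - b \<and> fitz_le (graph_of ?S) a s r \<and> fitz_le (graph_of ?T) b t q"
    if y: "y \<in> Y" for y
  proof -
    obtain \<tau> where \<tau>: "\<tau> > 0" "\<tau> *\<^sub>R y \<in> ?U" using cone_hull_scale_into[OF U0] y by (auto simp: Y_def)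
    obtain a b where ab: "\<tau> *\<^sub>R y = a - b" "a \<in> op_domain ?S" "b \<in> op_domain ?T"
      by (rule minkowski_diffE[OF \<tau>(2)])
    obtain s t where "(a, s) \<in> graph_of ?S" "(b, t) \<in> graph_of ?T" using ab by (auto simp: op_domain_iff)
    from fitz_le_member[OF M this(1)] fitz_le_member[OF N this(2)] show ?thesis using \<tau>(1) ab(1) by blast
  qed
  have monoH: "monotone_bifunction C ?H"
    unfolding monotone_bifunction_def
  proof (intro ballI)
    fix x y assume "x \<in> C" "y \<in> C"
    then have "F x y + F y x \<le> 0" "G x y + G y x \<le> 0"
      using F G by (simp_all add: maximal_monotone_bifunction_def monotone_bifunction_def)
    then show "F x y + G x y + (F y x + G y x) \<le> 0" by linarith
  qed
  have mono: "monotone_operator (bifun_operator C ?H)"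
    using diag by (intro monotone_bifun_operator[OF monoH]) simp
  have inc: "u + v \<in> bifun_operator C ?H x" if "(x, u) \<in> graph_of ?S" "(x, v) \<in> graph_of ?T" for x u v
    using that bifun_operator_add by (auto simp: graph_of_def)
  \<comment> \<open>Relatedness to the operator of F + G implies, through \<open>inc\<close>,
    relatedness to every sum of graph points, which is the hypothesis of
    \<open>sum_maximal\<close>.\<close>
  have maxi: "\<exists>u v. (x0, u) \<in> graph_of ?S \<and> (x0, v) \<in> graph_of ?T \<and> u0 = u + v"
    if rel: "\<And>x w. w \<in> bifun_operator C ?H x \<Longrightarrow> 0 \<le> (u0 - w) (x0 - x)" for x0 u0
    by (rule sum_maximal[OF refl M N Y MN dom rel[OF inc]])
  have sub: "\<exists>u v. (x0, u) \<in> graph_of ?S \<and> (x0, v) \<in> graph_of ?T \<and> u0 = u + v"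
    if "u0 \<in> bifun_operator C ?H x0" for x0 u0
    by (rule maxi) (rule mono[unfolded monotone_operator_iff, rule_format, OF that])
  have "maxmono (graph_of (bifun_operator C ?H))"
    unfolding maxmono_def
  proof (intro conjI allI impI)
    fix x u y v
    assume "(x, u) \<in> graph_of (bifun_operator C ?H)" "(y, v) \<in> graph_of (bifun_operator C ?H)"
    then show "0 \<le> (u - v) (x - y)"
      using mono[unfolded monotone_operator_iff, rule_format, of u x v y] by (simp add: graph_of_def)
  next
    fix x0 u0
    assume "\<forall>y v. (y, v) \<in> graph_of (bifun_operator C ?H) \<longrightarrow> 0 \<le> (u0 - v) (x0 - y)"
    then obtain u v where "(x0, u) \<in> graph_of ?S" "(x0, v) \<in> graph_of ?T" "u0 = u + v"
      using maxi[of u0 x0] by (auto simp: graph_of_def)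
    then show "(x0, u0) \<in> graph_of (bifun_operator C ?H)" using inc by (simp add: graph_of_def)
  qed
  then show "maximal_monotone_bifunction C ?H"
    using monoH by (simp add: maximal_monotone_bifunction_def maximal_monotone_operator_iff)
  show "(\<lambda>x. ?S x + ?T x) = bifun_operator C ?H"
  proof (intro ext set_eqI iffI)
    fix x w assume "w \<in> ?S x + ?T x"
    then show "w \<in> bifun_operator C ?H x" using bifun_operator_add by (auto elim!: set_plus_elim)
  next
    fix x w assume "w \<in> bifun_operator C ?H x"
    from sub[OF this] show "w \<in> ?S x + ?T x" by (auto simp: graph_of_def intro: set_plus_intro)
  qed
qed

text \<open>At a graph point w = u + v, the choice u in the infimum attains the duality product,
  which is also the lower bound from \<open>inf_conv2_ge\<close>.\<close>

lemma inf_conv2_representative: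
  fixes S T R :: "'a::banach \<Rightarrow> ('a \<Rightarrow>\<^sub>L real) set"
  assumes refl: "reflexive_space TYPE('a)"
    and M: "maxmono (graph_of S)" and N: "maxmono (graph_of T)"
    and f: "representative_function S f" and g: "representative_function T g"
    and sq: "0 \<in> sqri (minkowski_diff (op_domain S) (op_domain T))"
    and R: "(\<lambda>x. S x + T x) = R" "monotone_operator R"
  shows "representative_function R (inf_conv2 f g)"
  unfolding representative_function_def
proof (intro conjI allI R(2) inf_conv2_convex[OF f g] inf_conv2_ge[OF f g])
  let ?U = "minkowski_diff (op_domain S) (op_domain T)"
  define Y where "Y = cone hull ?U"
  have Y: "closed Y" "subspace Y" and U0: "0 \<in> ?U" using sq by (simp_all add: zero_in_sqri_iff Y_def)
  have UY: "?U \<subseteq> Y" unfolding Y_def by (rule hull_subset)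
  show "lower_semicontinuous (inf_conv2 f g)"
  proof (rule inf_conv2_lower_semicontinuous[OF refl M N f g Y])
    fix a s b t assume "(a, s) \<in> graph_of S" "(b, t) \<in> graph_of T"
    then show "a - b \<in> Y"
      by (intro subsetD[OF UY] minkowski_diffI) (rule graph_in_op_domain, assumption)+
  next
    fix y assume "y \<in> Y"
    then obtain \<tau> where \<tau>: "\<tau> > 0" "\<tau> *\<^sub>R y \<in> ?U" using cone_hull_scale_into[OF U0] by (auto simp: Y_def)
    obtain a b where ab: "\<tau> *\<^sub>R y = a - b" "a \<in> op_domain S" "b \<in> op_domain T"
      by (rule minkowski_diffE[OF \<tau>(2)])
    obtain s t where "(a, s) \<in> graph_of S" "(b, t) \<in> graph_of T" using ab by (auto simp: op_domain_iff)
    then show "\<exists>\<tau>>0. \<exists>a s b t. \<tau> *\<^sub>R y = a - b \<and> (a, s) \<in> graph_of S \<and> (b, t) \<in> graph_of T"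
      using \<tau>(1) ab(1) by blast
  qed
  show "graph_of R \<subseteq> {(x, u). inf_conv2 f g (x, u) = ereal (blinfun_apply u x)}"
  proof clarify
    fix x w assume "(x, w) \<in> graph_of R"
    then have "w \<in> S x + T x" using R(1) by (auto simp: graph_of_def)
    then obtain u v where w: "w = u + v" "u \<in> S x" "v \<in> T x" by (rule set_plus_elim)
    have "inf_conv2 f g (x, w) \<le> f (x, u) + g (x, w - u)"
      unfolding inf_conv2_def by (auto intro: INF_lower)
    also have "\<dots> = ereal (w x)"
      using w representative_eq[OF f, of x u] representative_eq[OF g, of x v]
      by (simp add: graph_of_def blinfun.add_left)
    finally show "inf_conv2 f g (x, w) = ereal (w x)"
      using inf_conv2_ge[OF f g, of w x] by (rule antisym)
  qed
qed

theorem theorem17: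
  fixes C :: "'a::banach set"
    and F G :: "'a \<Rightarrow> 'a \<Rightarrow> real"
    and f\<^sub>F f\<^sub>G :: "'a \<times> ('a \<Rightarrow>\<^sub>L real) \<Rightarrow> ereal"
  assumes "\<exists>x::'a. x \<noteq> 0"
    and "reflexive_space TYPE('a)"
    and "C \<noteq> {}"
    and "maximal_monotone_bifunction C F"
    and "maximal_monotone_bifunction C G"
    and "\<forall>x\<in>C. F x x = 0 \<and> G x x = 0"
    and "representative_function (bifun_operator C F) f\<^sub>F"
    and "representative_function (bifun_operator C G) f\<^sub>G"
  shows "(0 \<in> sqri (minkowski_diff (op_domain (bifun_operator C F)) (op_domain (bifun_operator C G)))
          \<longleftrightarrow> 0 \<in> sqri (minkowski_diff (fst ` effective_domain f\<^sub>F) (fst ` effective_domain f\<^sub>G)))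
       \<and> (0 \<in> sqri (minkowski_diff (op_domain (bifun_operator C F)) (op_domain (bifun_operator C G)))
          \<longrightarrow> maximal_monotone_bifunction C (\<lambda>x y. F x y + G x y)
            \<and> (\<lambda>x. bifun_operator C F x + bifun_operator C G x)
                = bifun_operator C (\<lambda>x y. F x y + G x y)
            \<and> representative_function (bifun_operator C (\<lambda>x y. F x y + G x y))
                (inf_conv2 f\<^sub>F f\<^sub>G))"
proof (intro conjI impI iffI)
  have M: "maxmono (graph_of (bifun_operator C F))" and N: "maxmono (graph_of (bifun_operator C G))"
    using assms(4,5) by (simp_all add: maximal_monotone_bifunction_def maximal_monotone_operator_iff)
  let ?A = "0 \<in> sqri (minkowski_diff (op_domain (bifun_operator C F)) (op_domain (bifun_operator C G)))"
  let ?B = "0 \<in> sqri (minkowski_diff (fst ` effective_domain f\<^sub>F) (fst ` effective_domain f\<^sub>G))"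
  show ?B if ?A
    using sqri_op_domain_imp_representative_domain[OF M N assms(7,8) that] .
  show ?A if ?B
    using sqri_representative_domain_imp_op_domain[OF assms(2) M N assms(7,8) that] .
  assume sq: ?A
  have diag: "F x x = 0 \<and> G x x = 0" if "x \<in> C" for x using assms(6) that by blast
  show max: "maximal_monotone_bifunction C (\<lambda>x y. F x y + G x y)"
    by (rule bifun_operator_sum(1)[OF assms(2,4,5) diag sq])
  show eq: "(\<lambda>x. bifun_operator C F x + bifun_operator C G x) = bifun_operator C (\<lambda>x y. F x y + G x y)"
    by (rule bifun_operator_sum(2)[OF assms(2,4,5) diag sq])
  show "representative_function (bifun_operator C (\<lambda>x y. F x y + G x y)) (inf_conv2 f\<^sub>F f\<^sub>G)"
    using max by (intro inf_conv2_representative[OF assms(2) M N assms(7,8) sq eq])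
      (simp add: maximal_monotone_bifunction_def maximal_monotone_operator_def)
qed

end
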